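(* Let $\phi:\mathbb{C}_+\to\mathbb{C}_{\frac12}$ be a holomorphic function which on some half-plane has the form $\phi(s)=c_0s+\varphi(s)$ with $c_0\in\mathbb{N}\cup\{0\}$ and $\varphi\in\mathcal{D}$. Then 1. $C_\phi(\mathcal{H}_+)\subseteq\mathcal{H}^\infty$ if and only if $\phi(\mathbb{C}_+)\subseteq\mathbb{C}_{\frac12+\varepsilon}$ for some $\varepsilon>0$; 2. $C_\phi(\mathcal{H}_+)\subseteq\mathcal{H}^\infty_+$ if and only if $\phi(\mathbb{C}_+)\subseteq\mathbb{C}_{\frac12}$.
   Context: For $\sigma\in\mathbb{R}$, $\mathbb{C}_\sigma=\{s\in\mathbb{C}:\operatorname{Re}s>\sigma\}$ and $\mathbb{C}_+=\mathbb{C}_0$. $\mathcal{D}$ is the space of Dirichlet series that converge at some point of $\mathbb{C}$. $\mathcal{H}^\infty$ is the space of Dirichlet series that define a bounded holomorphic function on $\mathbb{C}_+$. $\mathcal{H}^\infty_+$ is the space of Dirichlet series $\sum a_nn^{-s}$ such that $\sum\frac{a_n}{n^\sigma}n^{-s}\in\mathcal{H}^\infty$ for every $\sigma>0$. $\mathcal{H}_{+}$ is the space of Dirichlet series $D=\sum a_nn^{-s}$ with $\sum_n|a_n|^2n^{-2\sigma}<\infty$ for every $\sigma>0$; each such series converges absolutely on $\mathbb{C}_{\frac12}$. $C_\phi(D)=D\circ\phi$, which for $D\in\mathcal{H}_+$ and $\phi$ as in the claim is represented on some half-plane by a Dirichlet series; the inclusions mean that this Dirichlet series lies in the indicated space for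 every $D\in\mathcal{H}_+$. *)

theory Defs
  imports "HOL-Complex_Analysis.Complex_Analysis"
begin

definition half_plane :: "real \<Rightarrow> complex set" where
  "half_plane \<sigma> = {s. Re s > \<sigma>}"

text \<open>A Dirichlet series $\sum_{n \ge 1} a_n n^{-s}$ is represented by its coefficient function
  \<open>a\<close>; the value \<open>a 0\<close> is never used.\<close>

type_synonym dirichlet_series = "nat \<Rightarrow> complex"

definition ds_term :: "dirichlet_series \<Rightarrow> complex \<Rightarrow> nat \<Rightarrow> complex" where
  "ds_term a s n = a (Suc n) * of_nat (Suc n) powr (-s)"

definition ds_converges :: "dirichlet_series \<Rightarrow> complex \<Rightarrow> bool" where
  "ds_converges a s \<longleftrightarrow> summable (ds_term a s)"

definition ds_sum :: "dirichlet_series \<Rightarrow> complex \<Rightarrow> complex" where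
  "ds_sum a s = (\<Sum>n. ds_term a s n)"

definition D_space :: "dirichlet_series set" where
  "D_space = {a. \<exists>s. ds_converges a s}"

definition H_inf :: "dirichlet_series set" where
  "H_inf = {a. (\<forall>s\<in>half_plane 0. ds_converges a s) \<and>
               ds_sum a holomorphic_on half_plane 0 \<and>
               bounded (ds_sum a ` half_plane 0)}"

definition H_inf_plus :: "dirichlet_series set" where
  "H_inf_plus = {a. \<forall>\<sigma>>0. (\<lambda>n. a n / of_real (real n powr \<sigma>)) \<in> H_inf}"

definition H_plus :: "dirichlet_series set" where
  "H_plus = {a. \<forall>\<sigma>>0. summable (\<lambda>n. (cmod (a (Suc n)))\<^sup>2 * real (Suc n) powr (-2 * \<sigma>))}"

text \<open>The series \<open>b\<close> represents the composition of \<open>a\<close> with \<open>\<phi>\<close> on some half-plane. The bound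
  \<open>\<sigma> \<ge> 0\<close> keeps the half-plane inside the domain of \<open>\<phi>\<close>, the right half-plane. By uniqueness
  of Dirichlet coefficients, \<open>b\<close> is determined up to the unused value \<open>b 0\<close>.\<close>

definition represents_comp ::
    "(complex \<Rightarrow> complex) \<Rightarrow> dirichlet_series \<Rightarrow> dirichlet_series \<Rightarrow> bool" where
  "represents_comp \<phi> a b \<longleftrightarrow>
     (\<exists>\<sigma>\<ge>0. \<forall>s\<in>half_plane \<sigma>.
        ds_converges a (\<phi> s) \<and> ds_converges b s \<and> ds_sum b s = ds_sum a (\<phi> s))"

text \<open>The inclusion $C_\phi(X) \subseteq Y$.\<close>

definition comp_maps_into ::
    "(complex \<Rightarrow> complex) \<Rightarrow> dirichlet_series set \<Rightarrow> dirichlet_series set \<Rightarrow> bool" where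
  "comp_maps_into \<phi> X Y \<longleftrightarrow> (\<forall>a\<in>X. \<exists>b\<in>Y. represents_comp \<phi> a b)"

end

theory Submission
  imports Defs "HOL-Real_Asymp.Real_Asymp"
begin

text \<open>
  Schwarz--Pick, applied to \<open>\<phi> - 1/2\<close> on the right half-plane, gives a Harnack inequality along horizontal
  lines. Since \<open>Re \<phi> - 1/2\<close> is bounded below far to the right, \<open>\<phi>\<close> maps each half-plane
  \<open>Re s > \<tau> > 0\<close> into some \<open>Re s > 1/2 + \<epsilon>\<close>, where every \<open>D\<close> in \<open>H_plus\<close> is bounded by
  Cauchy--Schwarz. Far to the right \<open>D \<circ> \<phi>\<close> is an absolutely convergent Dirichlet series: it is an
  absolutely summable combination of exponentials in a weighted \<open>\<ell>\<^sup>1\<close> convolution algebra. Bohr's theorem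
  (a Dirichlet series with a bounded continuation to the right half-plane converges there), obtained
  from a Perron formula for the partial sums of the coefficients, then yields the sufficiency claims.
  For necessity, if \<open>\<phi>\<close> approaches the line \<open>Re s = 1/2\<close>, a gliding hump
  produces \<open>D\<close> in \<open>H_plus\<close> that is unbounded on the range of \<open>\<phi>\<close>.
\<close>

text \<open>The main obstacle: \<open>represents_comp\<close> speaks only about points far to the
  right, while \<open>H_inf\<close> demands convergence at every s with Re s > 0. Boundedness of the
  continuation gives no direct hold on the series there. It does control the partial sums of the
  coefficients: if these are O(N^\<kappa>) for every \<kappa> > 0, Abel summation yields convergence
  and holomorphy on the whole half-plane. The usual Perron kernel 1/w against a merely bounded
  function is not absolutely integrable on vertical lines; this is why the kernel 1/(w(w+1))
  appears, and why two bounds for its numerator are interpolated at the cost of a factor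
  N^(2\<kappa>).

  The critical abscissa 1/2 is sharp because coefficients of modulus at most n^(-1/2) belong to
  \<open>H_plus\<close>, while with all phases aligned at w the sum becomes \<zeta>(1/2 + Re w),
  which blows up as Re w tends to 1/2. The phases that suit one w need not suit another, so a single
  unbounded series has to be assembled from blocks.

  In the second claim the condition on the range is the standing hypothesis on \<phi>, so its
  content is the inclusion.\<close>

lemma half_plane_simps [simp]:
  "s \<in> half_plane \<sigma> \<longleftrightarrow> \<sigma> < Re s" "open (half_plane \<sigma>)" "convex (half_plane \<sigma>)"
  by (auto simp: half_plane_def open_halfspace_Re_gt convex_halfspace_Re_gt)

lemma norm_nat_powr: "norm (of_nat (Suc n) powr s :: complex) = real (Suc n) powr Re s"
  using norm_powr_real_powr[of "of_nat (Suc n)" s] by simp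

lemma norm_ds_term: "norm (ds_term a s n) = norm (a (Suc n)) * real (Suc n) powr (- Re s)"
  unfolding ds_term_def norm_mult norm_nat_powr by simp

lemma half_plane_identity:
  assumes "f holomorphic_on half_plane a" "g holomorphic_on half_plane a"
    and "\<And>z. c < Re z \<Longrightarrow> a < Re z \<Longrightarrow> f z = g z" and "a < Re z"
  shows "f z = g z"
proof (rule analytic_continuation_open[where f = f and g = g])
  have "of_real (max a c + 1) \<in> half_plane (max a c)" by simp
  thus "half_plane (max a c) \<noteq> {}" by blast
  show "connected (half_plane a)" by (simp add: convex_connected)
qed (use assms in auto)

section \<open>Harnack inequality along horizontal lines\<close>

text \<open>\<open>(A - B) / (A + cnj B)\<close> is the Cayley quotient of the right half-plane. The
  identity shows that its modulus is below 1 when both real parts are positive, and it later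
  eliminates \<open>cmod (g z - g w)\<close> from Schwarz-Pick.\<close>

lemma cmod_power2_diff_cnj:
  "(cmod (A - B))\<^sup>2 = (cmod (A + cnj B))\<^sup>2 - 4 * Re A * Re B"
  unfolding cmod_power2 by (simp add: power2_eq_square algebra_simps)

text \<open>Schwarz's lemma for g conjugated by two Cayley maps, one sending w to 0 and the other
  sending \<open>g w\<close> to 0. The cross-multiplied form keeps denominators out of the
  applications.\<close>

lemma schwarz_pick_right_half_plane:
  assumes hol: "g holomorphic_on half_plane 0" and into: "g ` half_plane 0 \<subseteq> half_plane 0"
    and z: "0 < Re z" and w: "0 < Re w"
  shows "cmod (g z - g w) * cmod (z + cnj w) \<le> cmod (z - w) * cmod (g z + cnj (g w))"
proof -
  have posg: "Re (g u) > 0" if "Re u > 0" for u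
    using into that by (auto simp: image_subset_iff)
  have nz: "A + cnj B \<noteq> 0" if "Re A > 0" "Re B > 0" for A B
    using that by (auto simp: complex_eq_iff)
  \<comment> \<open>The inverse of z \<mapsto> (z - w)/(z + cnj w), obtained by solving for z; hence
    \<open>\<psi> 0 = w\<close>.\<close>
  define \<psi> where "\<psi> \<zeta> = (w + cnj w * \<zeta>) / (1 - \<zeta>)" for \<zeta>
  have Re\<psi>: "Re (\<psi> \<zeta>) > 0" if "norm \<zeta> < 1" for \<zeta>
  proof -
    have "Re (\<psi> \<zeta>) = Re w * (1 - (cmod \<zeta>)\<^sup>2) / (cmod (1 - \<zeta>))\<^sup>2"
      unfolding \<psi>_def Re_divide cmod_power2
      by (simp add: power2_eq_square add_divide_distrib diff_divide_distrib algebra_simps)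
    moreover have "(cmod \<zeta>)\<^sup>2 < 1" using that by (simp add: power_less_one_iff)
    moreover have "1 - \<zeta> \<noteq> 0" using that by auto
    ultimately show ?thesis using w by simp
  qed
  define h where "h \<zeta> = (g (\<psi> \<zeta>) - g w) / (g (\<psi> \<zeta>) + cnj (g w))" for \<zeta>
  have hol\<psi>: "\<psi> holomorphic_on ball 0 1"
    unfolding \<psi>_def by (intro holomorphic_intros) auto
  have holg\<psi>: "(\<lambda>\<zeta>. g (\<psi> \<zeta>)) holomorphic_on ball 0 1"
    using holomorphic_on_compose_gen[OF hol\<psi> hol] Re\<psi> by (auto simp: o_def image_subset_iff)
  have holh: "h holomorphic_on ball 0 1"
    unfolding h_def by (intro holomorphic_intros holg\<psi>) (use nz posg Re\<psi> w in auto)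
  have h0: "h 0 = 0" by (simp add: h_def \<psi>_def)
  have h1: "norm (h \<zeta>) < 1" if "norm \<zeta> < 1" for \<zeta>
  proof -
    have "Re (g (\<psi> \<zeta>)) * Re (g w) > 0" using posg Re\<psi> that w by simp
    hence "(cmod (g (\<psi> \<zeta>) - g w))\<^sup>2 < (cmod (g (\<psi> \<zeta>) + cnj (g w)))\<^sup>2"
      unfolding cmod_power2_diff_cnj by (simp add: mult.commute)
    hence "cmod (g (\<psi> \<zeta>) - g w) < cmod (g (\<psi> \<zeta>) + cnj (g w))"
      by (simp add: power2_less_imp_less)
    thus ?thesis by (simp add: h_def norm_divide divide_simps)
  qed
  define \<xi> where "\<xi> = (z - w) / (z + cnj w)"
  have "(cmod (z - w))\<^sup>2 < (cmod (z + cnj w))\<^sup>2"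
    unfolding cmod_power2_diff_cnj using z w by simp
  hence "cmod (z - w) < cmod (z + cnj w)" by (simp add: power2_less_imp_less)
  hence \<xi>1: "norm \<xi> < 1" by (simp add: \<xi>_def norm_divide divide_simps)
  have zw: "z + cnj w \<noteq> 0" using nz z w by blast
  have "w + cnj w \<noteq> 0" using nz w by blast
  have "1 - \<xi> = (w + cnj w) / (z + cnj w)" using zw by (simp add: \<xi>_def field_simps)
  moreover have "w + cnj w * \<xi> = z * (w + cnj w) / (z + cnj w)"
    using zw by (simp add: \<xi>_def field_simps)
  ultimately have \<psi>\<xi>: "\<psi> \<xi> = z" unfolding \<psi>_def using zw \<open>w + cnj w \<noteq> 0\<close> by simp
  have "h \<xi> = (g z - g w) / (g z + cnj (g w))" by (simp add: h_def \<psi>\<xi>)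
  hence "norm ((g z - g w) / (g z + cnj (g w))) \<le> norm ((z - w) / (z + cnj w))"
    using Schwarz_Lemma(1)[OF holh h0 h1 \<xi>1] by (simp only: \<xi>_def)
  thus ?thesis
    using zw nz[OF posg[OF z] posg[OF w]]
    by (simp add: norm_divide divide_simps mult.commute)
qed

text \<open>On a horizontal line both \<open>z - w\<close> and \<open>z + cnj w\<close> are real, so
  Schwarz-Pick becomes an inequality between real parts once the imaginary part of
  \<open>g z + cnj (g w)\<close> is discarded.\<close>

lemma harnack_horizontal:
  assumes hol: "g holomorphic_on half_plane 0" and into: "g ` half_plane 0 \<subseteq> half_plane 0"
    and z: "0 < Re z" and w: "0 < Re w" and Im: "Im z = Im w"
  shows "min (Re z / Re w) (Re w / Re z) * Re (g w) \<le> Re (g z)"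
proof -
  define p q x y where "p = Re (g z)" and "q = Re (g w)" and "x = Re z" and "y = Re w"
  have pos: "p > 0" "q > 0" "x > 0" "y > 0"
    using assms by (auto simp: p_def q_def x_def y_def image_subset_iff)
  have d: "z - w = of_real (x - y)" "z + cnj w = of_real (x + y)"
    using Im by (auto simp: x_def y_def complex_eq_iff)
  have "cmod (g z - g w) * cmod (z + cnj w) \<le> cmod (z - w) * cmod (g z + cnj (g w))"
    using schwarz_pick_right_half_plane assms by blast
  hence "(cmod (g z - g w) * (x + y))\<^sup>2 \<le> (\<bar>x - y\<bar> * cmod (g z + cnj (g w)))\<^sup>2"
    unfolding d using pos by (intro power_mono) (auto simp flip: of_real_add of_real_diff)
  hence "((cmod (g z + cnj (g w)))\<^sup>2 - 4 * p * q) * (x + y)\<^sup>2 \<le> (x - y)\<^sup>2 * (cmod (g z + cnj (g w)))\<^sup>2"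
    unfolding power_mult_distrib cmod_power2_diff_cnj p_def q_def by simp
  hence "x * y * (cmod (g z + cnj (g w)))\<^sup>2 \<le> p * q * (x + y)\<^sup>2"
    by (simp add: power2_eq_square algebra_simps)
  moreover have "x * y * (p + q)\<^sup>2 \<le> x * y * (cmod (g z + cnj (g w)))\<^sup>2"
    using pos by (intro mult_left_mono) (auto simp: cmod_power2 p_def q_def)
  ultimately have "x * y * (p + q)\<^sup>2 \<le> p * q * (x + y)\<^sup>2" by linarith
  \<comment> \<open>The common term 2pqxy cancels and the difference factors. Two factors of equal
    sign place p/q between x/y and y/x.\<close>
  hence key: "0 \<le> (p * x - q * y) * (q * x - p * y)"
    by (simp add: power2_eq_square algebra_simps)
  show ?thesis
  proof (cases "x \<le> y")
    case True
    have "q * x \<le> p * y"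
    proof (rule ccontr)
      assume a: "\<not> q * x \<le> p * y"
      hence "p * x \<ge> q * y" using key by (simp add: zero_le_mult_iff)
      moreover have "q * y \<ge> q * x" "p * y \<ge> p * x" using True pos by auto
      ultimately show False using a by linarith
    qed
    hence "x / y * q \<le> p" using pos by (simp add: field_simps)
    moreover have "min (x / y) (y / x) * q \<le> x / y * q" using pos by (intro mult_right_mono) auto
    ultimately show ?thesis unfolding p_def q_def x_def y_def by linarith
  next
    case False
    have "q * y \<le> p * x"
    proof (rule ccontr)
      assume a: "\<not> q * y \<le> p * x"
      hence "q * x \<le> p * y" using key by (simp add: zero_le_mult_iff)
      moreover have "q * x \<ge> q * y" "p * x \<ge> p * y" using False pos by auto
      ultimately show False using a by linarith
    qed
    hence "y / x * q \<le> p" using pos by (simp add: field_simps)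
    moreover have "min (x / y) (y / x) * q \<le> y / x * q" using pos by (intro mult_right_mono) auto
    ultimately show ?thesis unfolding p_def q_def x_def y_def by linarith
  qed
qed

section \<open>Perron kernels\<close>

text \<open>The mean value inequality along a real segment. The bound M stays free because x^(Re z -
  1) is increasing in one application (z = w + 1) and decreasing in the other (z = -y).\<close>

lemma powr_diff_bound:
  fixes a b M :: real and z :: complex
  assumes "0 < a" "a \<le> b" and M: "\<And>x. x \<in> {a..b} \<Longrightarrow> x powr (Re z - 1) \<le> M"
  shows "norm (of_real b powr z - of_real a powr z) \<le> norm z * M * (b - a)"
proof -
  have seg: "\<exists>x\<in>{a..b}. w = of_real x" if "w \<in> closed_segment (of_real a) (of_real b :: complex)" for w
  proof -
    have "w \<in> of_real ` closed_segment a b"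
      using that by (simp add: closed_segment_of_real)
    thus ?thesis using assms by (auto simp: closed_segment_eq_real_ivl)
  qed
  have "norm (of_real b powr z - of_real a powr z) \<le> (norm z * M) * norm (of_real b - of_real a :: complex)"
  proof (rule field_differentiable_bound[where S = "closed_segment (of_real a) (of_real b)"
        and f' = "\<lambda>w. z * w powr (z - 1)"])
    fix w :: complex assume "w \<in> closed_segment (of_real a) (of_real b)"
    then obtain x where x: "x \<in> {a..b}" "w = of_real x" using seg by blast
    have "x > 0" using x assms by auto
    hence "w \<notin> \<real>\<^sub>\<le>\<^sub>0" using x by simp
    thus "((\<lambda>w. w powr z) has_field_derivative z * w powr (z - 1))
            (at w within closed_segment (of_real a) (of_real b))"
      by (intro has_field_derivative_powr has_field_derivative_at_within)
    show "norm (z * w powr (z - 1)) \<le> norm z * M"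
      unfolding norm_mult using M[OF x(1)] \<open>x > 0\<close> x
      by (intro mult_left_mono) (auto simp: norm_powr_real_powr)
  qed auto
  also have "norm (of_real b - of_real a :: complex) = b - a"
    using assms by (simp flip: of_real_diff)
  finally show ?thesis .
qed

lemma contour_integral_rectpath:
  assumes "continuous_on (path_image (rectpath a1 a3)) f"
  defines "a2 \<equiv> Complex (Re a3) (Im a1)" and "a4 \<equiv> Complex (Re a1) (Im a3)"
  shows "contour_integral (rectpath a1 a3) f =
    contour_integral (linepath a1 a2) f + contour_integral (linepath a2 a3) f +
    contour_integral (linepath a3 a4) f + contour_integral (linepath a4 a1) f"
proof -
  have rp: "rectpath a1 a3 = linepath a1 a2 +++ linepath a2 a3 +++ linepath a3 a4 +++ linepath a4 a1"
    by (simp add: rectpath_def Let_def a2_def a4_def)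
  have pi: "path_image (rectpath a1 a3) = closed_segment a1 a2 \<union> closed_segment a2 a3 \<union>
       closed_segment a3 a4 \<union> closed_segment a4 a1"
    by (simp add: rp path_image_join Un_assoc)
  have "f contour_integrable_on linepath a1 a2" "f contour_integrable_on linepath a2 a3"
    "f contour_integrable_on linepath a3 a4" "f contour_integrable_on linepath a4 a1"
    using assms(1) unfolding pi
    by (auto intro!: contour_integrable_continuous_linepath elim: continuous_on_subset)
  thus ?thesis unfolding rp by simp
qed

section \<open>Integrals along vertical segments\<close>

lemma norm_Complex_diff:
  "cmod (Complex x v - Complex y v) = \<bar>x - y\<bar>" "cmod (Complex u x - Complex u y) = \<bar>x - y\<bar>"
  by (simp_all add: cmod_def)

text \<open>Integrals over vertical lines are treated as symmetric limits R \<rightarrow>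
  \<infinity> of these truncations. The factor 1/(2 pi i) is not included, so 2 pi i appears in the
  limits.\<close>

definition vert_integral :: "real \<Rightarrow> (complex \<Rightarrow> complex) \<Rightarrow> real \<Rightarrow> complex" where
  "vert_integral c G R = contour_integral (linepath (Complex c (- R)) (Complex c R)) G"

lemma vert_integral_reverse:
  "contour_integral (linepath (Complex c R) (Complex c (- R))) G = - vert_integral c G R"
  if "continuous_on (closed_segment (Complex c (- R)) (Complex c R)) G"
  unfolding vert_integral_def
  using contour_integral_reverse_linepath[OF that] by simp

lemma closed_segment_vertical: "w \<in> closed_segment (Complex c u) (Complex c v) \<Longrightarrow> Re w = c"
  by (simp add: closed_segment_same_Re)

lemma vert_integral_integrable:
  assumes "continuous_on {w. Re w = c} G"
  shows "G contour_integrable_on linepath (Complex c u) (Complex c v)"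
  by (intro contour_integrable_continuous_linepath continuous_on_subset[OF assms])
     (auto dest: closed_segment_vertical)

text \<open>For R \<ge> 2 one has R - 1 \<ge> R/2, which bounds the second factor. The disjunction
  covers the horizontal edges of a rectangle and its distant vertical edges at once.\<close>

lemma kernel_norm_ge:
  fixes w :: complex
  assumes "2 \<le> R" "R \<le> \<bar>Im w\<bar> \<or> (R \<le> \<bar>Re w\<bar>)"
  shows "R\<^sup>2 / 2 \<le> norm (w * (w + 1))"
proof -
  have "R \<le> norm w" using assms(2) abs_Im_le_cmod[of w] abs_Re_le_cmod[of w] by linarith
  moreover have "norm w - 1 \<le> norm (w + 1)" using norm_triangle_ineq4[of "w + 1" 1] by simp
  ultimately have "R * (R / 2) \<le> norm w * norm (w + 1)"
    using assms(1) by (intro mult_mono) auto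
  thus ?thesis by (simp add: norm_mult power2_eq_square)
qed

lemma kernel_bound:
  fixes w z :: complex
  assumes "2 \<le> R" "R \<le> \<bar>Im w\<bar> \<or> R \<le> \<bar>Re w\<bar>" "norm z \<le> B"
  shows "norm (z / (w * (w + 1))) \<le> 2 * B / R\<^sup>2"
proof -
  have "norm z / norm (w * (w + 1)) \<le> B / (R\<^sup>2 / 2)"
    using kernel_norm_ge[OF assms(1,2)] assms order.trans[OF norm_ge_zero assms(3)] by (intro frac_le) auto
  thus ?thesis by (simp add: norm_divide mult.commute)
qed

text \<open>By Cauchy's theorem the two vertical integrals differ by the two horizontal edges alone,
  each of length b - a at height R, where the integrand is at most 2B/R^2.\<close>

lemma vert_integral_shift_bound:
  assumes hol: "H holomorphic_on half_plane 0" and ab: "0 < a" "a \<le> b" and R: "2 \<le> R"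
    and B: "\<And>w. Re w \<in> {a..b} \<Longrightarrow> norm (H w) \<le> B"
  shows "norm (vert_integral a (\<lambda>w. H w / (w * (w + 1))) R -
               vert_integral b (\<lambda>w. H w / (w * (w + 1))) R) \<le> 4 * B * (b - a) / R\<^sup>2"
proof -
  define G where "G = (\<lambda>w. H w / (w * (w + 1)))"
  have nz: "w \<noteq> 0" "w + 1 \<noteq> 0" if "Re w > 0" for w using that by (auto simp: complex_eq_iff)
  have holG: "G holomorphic_on half_plane 0"
    unfolding G_def by (intro holomorphic_intros hol) (use nz in auto)
  note contG = holomorphic_on_imp_continuous_on[OF holG]
  define a1 a2 a3 a4 where "a1 = Complex a (-R)" and "a2 = Complex b (-R)"
    and "a3 = Complex b R" and "a4 = Complex a R"
  have sub: "path_image (rectpath a1 a3) \<subseteq> half_plane 0"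
    using ab R by (auto simp: path_image_rectpath a1_def a3_def)
  have "(G has_contour_integral 0) (rectpath a1 a3)"
    using Cauchy_theorem_convex_simple[OF holG _ _ sub] by simp
  hence 0: "0 = contour_integral (linepath a1 a2) G + contour_integral (linepath a2 a3) G +
    contour_integral (linepath a3 a4) G + contour_integral (linepath a4 a1) G"
    using contour_integral_rectpath[OF continuous_on_subset[OF contG sub]]
    by (simp add: contour_integral_unique a1_def a2_def a3_def a4_def)
  have B0: "B \<ge> 0" using order.trans[OF norm_ge_zero B[of "of_real a"]] ab by simp
  have hor: "norm (contour_integral (linepath (Complex u v) (Complex u' v)) G) \<le> 2 * B / R\<^sup>2 * (b - a)"
    if "\<bar>v\<bar> = R" "u \<in> {a..b}" "u' \<in> {a..b}" for u u' v
  proof -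
    have seg: "Im w = v \<and> Re w \<in> {a..b}" if "w \<in> closed_segment (Complex u v) (Complex u' v)" for w
      using that \<open>u \<in> _\<close> \<open>u' \<in> _\<close> by (auto simp: closed_segment_same_Im closed_segment_eq_real_ivl split: if_splits)
    have "norm (contour_integral (linepath (Complex u v) (Complex u' v)) G)
       \<le> 2 * B / R\<^sup>2 * norm (Complex u' v - Complex u v)"
    proof (rule contour_integral_bound_linepath)
      show "G contour_integrable_on linepath (Complex u v) (Complex u' v)"
        by (intro contour_integrable_continuous_linepath continuous_on_subset[OF contG])
           (use seg ab in fastforce)
      show "norm (G w) \<le> 2 * B / R\<^sup>2" if "w \<in> closed_segment (Complex u v) (Complex u' v)" for w
        unfolding G_def using seg[OF that] \<open>\<bar>v\<bar> = R\<close> R B by (intro kernel_bound) auto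
    qed (use B0 in auto)
    also have "norm (Complex u' v - Complex u v) = \<bar>u' - u\<bar>"
      by (rule norm_Complex_diff)
    also have "2 * B / R\<^sup>2 * \<bar>u' - u\<bar> \<le> 2 * B / R\<^sup>2 * (b - a)"
      using that B0 by (intro mult_left_mono) auto
    finally show ?thesis .
  qed
  have "continuous_on (closed_segment (Complex a (- R)) (Complex a R)) G"
    by (rule continuous_on_subset[OF contG]) (use ab in \<open>auto dest: closed_segment_vertical\<close>)
  from vert_integral_reverse[OF this] 0
  have "vert_integral a G R - vert_integral b G R =
      contour_integral (linepath a1 a2) G + contour_integral (linepath a3 a4) G"
    by (simp add: a1_def a2_def a3_def a4_def vert_integral_def algebra_simps)
  also have "norm \<dots> \<le> 2 * B / R\<^sup>2 * (b - a) + 2 * B / R\<^sup>2 * (b - a)"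
    unfolding a1_def a2_def a3_def a4_def
    by (rule norm_triangle_le, rule add_mono) (rule hor; use ab R in auto)+
  finally show ?thesis unfolding G_def by (simp add: field_simps)
qed

lemma vert_integral_shift:
  assumes "H holomorphic_on half_plane 0" "0 < a" "a \<le> b"
    and "\<And>w. Re w \<in> {a..b} \<Longrightarrow> norm (H w) \<le> B"
  shows "((\<lambda>R. vert_integral a (\<lambda>w. H w / (w * (w + 1))) R -
               vert_integral b (\<lambda>w. H w / (w * (w + 1))) R) \<longlongrightarrow> 0) at_top"
proof (rule Lim_null_comparison)
  show "\<forall>\<^sub>F R in at_top. norm (vert_integral a (\<lambda>w. H w / (w * (w + 1))) R -
               vert_integral b (\<lambda>w. H w / (w * (w + 1))) R) \<le> 4 * B * (b - a) / R\<^sup>2"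
    using eventually_ge_at_top[of 2] by eventually_elim (rule vert_integral_shift_bound[OF assms(1-3)], use assms(4) in auto)
  show "((\<lambda>R. 4 * B * (b - a) / R\<^sup>2) \<longlongrightarrow> 0) at_top"
    by (intro tendsto_divide_0[OF tendsto_const] filterlim_at_top_imp_at_infinity
        filterlim_pow_at_top filterlim_ident) auto
qed

lemma vert_integral_bound:
  assumes "continuous_on {w. Re w = c} G" "0 \<le> R" "0 \<le> B" "\<And>w. Re w = c \<Longrightarrow> norm (G w) \<le> B"
  shows "norm (vert_integral c G R) \<le> 2 * R * B"
proof -
  have "norm (vert_integral c G R) \<le> B * norm (Complex c R - Complex c (-R))"
    unfolding vert_integral_def
    by (rule contour_integral_bound_linepath[OF vert_integral_integrable])
       (use assms in \<open>auto dest: closed_segment_vertical\<close>)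
  also have "norm (Complex c R - Complex c (-R)) = 2 * R"
    using assms(2) by (simp add: norm_Complex_diff)
  finally show ?thesis by (simp add: mult_ac)
qed

lemma continuous_on_kernel:
  assumes "H holomorphic_on half_plane 0" "0 < c"
  shows "continuous_on {w. Re w = c} (\<lambda>w. H w / (w * (w + 1)))"
proof -
  have nz: "w \<noteq> 0" "w + 1 \<noteq> 0" if "Re w > 0" for w using that by (auto simp: complex_eq_iff)
  have "continuous_on {w. Re w = c} H"
    by (rule continuous_on_subset[OF holomorphic_on_imp_continuous_on[OF assms(1)]]) (use assms in auto)
  thus ?thesis using nz assms(2) by (intro continuous_intros) auto
qed

text \<open>The line is moved to the right by the truncation height R itself. The horizontal edges
  then contribute at most 4B/R, and on the new line the integrand is at most 2B/R^2 over a length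
  2R, again 4B/R.\<close>

lemma vert_integral_tendsto_0:
  assumes hol: "H holomorphic_on half_plane 0" and c: "0 < c"
    and B: "\<And>w. c \<le> Re w \<Longrightarrow> norm (H w) \<le> B"
  shows "((\<lambda>R. vert_integral c (\<lambda>w. H w / (w * (w + 1))) R) \<longlongrightarrow> 0) at_top"
proof (rule Lim_null_comparison)
  have B0: "B \<ge> 0" using order.trans[OF norm_ge_zero B[of "of_real c"]] by simp
  let ?v = "\<lambda>c. vert_integral c (\<lambda>w. H w / (w * (w + 1)))"
  show "\<forall>\<^sub>F R in at_top. norm (?v c R) \<le> 8 * B / R"
    using eventually_ge_at_top[of 2]
  proof eventually_elim
    case (elim R)
    have "norm (?v c R - ?v (c + R) R) \<le> 4 * B * ((c + R) - c) / R\<^sup>2"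
      by (rule vert_integral_shift_bound[OF hol]) (use c elim B in auto)
    moreover have "norm (?v (c + R) R) \<le> 2 * R * (2 * B / R\<^sup>2)"
    proof (rule vert_integral_bound[OF continuous_on_kernel[OF hol]])
      show "norm (H w / (w * (w + 1))) \<le> 2 * B / R\<^sup>2" if "Re w = c + R" for w
        using that c elim B by (intro kernel_bound) auto
    qed (use c elim B0 in auto)
    ultimately have "norm (?v c R) \<le> 4 * B * ((c + R) - c) / R\<^sup>2 + 2 * R * (2 * B / R\<^sup>2)"
      using norm_triangle_sub[of "?v c R" "?v (c + R) R"] by linarith
    also have "\<dots> = 8 * B / R" using elim by (simp add: field_simps power2_eq_square)
    finally show ?case .
  qed
  show "((\<lambda>R. 8 * B / R) \<longlongrightarrow> 0) at_top"
    by (intro tendsto_divide_0[OF tendsto_const] filterlim_at_top_imp_at_infinity filterlim_ident)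
qed

section \<open>Perron's formula for partial sums\<close>

lemma perron_kernel_rectangle:
  assumes y: "1 \<le> y" and c: "0 < c" and R: "2 \<le> R" "c \<le> R"
  shows "norm (vert_integral c (\<lambda>w. of_real y powr w / (w * (w + 1))) R - 2 * pi * \<i> * of_real (1 - 1 / y))
     \<le> 12 * y powr c / R"
proof -
  define f where "f = (\<lambda>w::complex. of_real y powr w)"
  define G where "G = (\<lambda>w. f w / (w * (w + 1)))"
  have holf: "f holomorphic_on A" for A
    unfolding f_def using y by (intro holomorphic_intros) auto
  define a1 a2 a3 a4 where "a1 = Complex (-R) (-R)" and "a2 = Complex c (-R)"
    and "a3 = Complex c R" and "a4 = Complex (-R) R"
  let ?r = "rectpath a1 a3"
  have box: "0 \<in> box a1 a3" "-1 \<in> box a1 a3"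
    using c R by (auto simp: in_box_complex_iff a1_def a3_def)
  have off: "w \<noteq> 0 \<and> w \<noteq> -1" if "w \<in> path_image ?r" for w
    using that path_image_rectpath_inter_box[of a1 a3] box c R by (auto simp: a1_def a3_def)
  have "((\<lambda>w. f w / (w - z)) has_contour_integral (2 * pi * \<i> * f z)) ?r" if "z \<in> {0, -1}" for z
  proof -
    have "path_image ?r \<subseteq> UNIV - {z}" using off that by auto
    moreover have "winding_number ?r z = 1" using that box by (auto intro!: winding_number_rectpath)
    ultimately show ?thesis
      using Cauchy_integral_formula_convex_simple[of UNIV f z ?r] holf by simp
  qed
  \<comment> \<open>Partial fractions: 1/(w(w+1)) = 1/w - 1/(w+1). Cauchy's formula handles each
    pole, and y^0 - y^(-1) is the limiting value.\<close>
  from this[of 0] this[of "-1"]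
  have "((\<lambda>w. f w / (w - 0) - f w / (w - (-1))) has_contour_integral (2 * pi * \<i> * f 0 - 2 * pi * \<i> * f (-1))) ?r"
    by (intro has_contour_integral_diff) auto
  hence "(G has_contour_integral (2 * pi * \<i> * f 0 - 2 * pi * \<i> * f (-1))) ?r"
  proof (rule has_contour_integral_eq)
    fix w assume "w \<in> path_image ?r"
    hence "w \<noteq> 0" "w + 1 \<noteq> 0" using off by (auto simp: eq_neg_iff_add_eq_0)
    thus "f w / (w - 0) - f w / (w - (-1)) = G w" by (simp add: G_def field_simps)
  qed
  moreover have "2 * pi * \<i> * f 0 - 2 * pi * \<i> * f (-1) = 2 * pi * \<i> * of_real (1 - 1 / y)"
    using y by (simp add: f_def powr_minus field_simps)
  ultimately have ci: "contour_integral ?r G = 2 * pi * \<i> * of_real (1 - 1 / y)"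
    using contour_integral_unique by metis
  have contG: "continuous_on (path_image ?r) G"
    unfolding G_def using off
    by (intro continuous_intros holomorphic_on_imp_continuous_on[OF holf])
       (auto simp: eq_neg_iff_add_eq_0)
  have pi: "path_image ?r = closed_segment a1 a2 \<union> closed_segment a2 a3 \<union>
       closed_segment a3 a4 \<union> closed_segment a4 a1"
    by (simp add: rectpath_def Let_def a1_def a2_def a3_def a4_def path_image_join Un_assoc)
  have bound: "norm (contour_integral (linepath u v) G) \<le> 2 * y powr c / R\<^sup>2 * norm (v - u)"
    if "closed_segment u v \<subseteq> path_image ?r"
      and "\<And>w. w \<in> closed_segment u v \<Longrightarrow> (R \<le> \<bar>Im w\<bar> \<or> R \<le> \<bar>Re w\<bar>) \<and> Re w \<le> c" for u v
  proof (rule contour_integral_bound_linepath)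
    show "G contour_integrable_on linepath u v"
      by (intro contour_integrable_continuous_linepath continuous_on_subset[OF contG] that)
    fix w assume w: "w \<in> closed_segment u v"
    \<comment> \<open>Closing the contour to the left is possible because y \<ge> 1: then y^(Re w)
      is largest on the edge Re w = c.\<close>
    have "norm (f w) \<le> y powr c"
      unfolding f_def using that(2)[OF w] y
      by (subst norm_powr_real_powr) (auto intro!: powr_mono)
    thus "norm (G w) \<le> 2 * y powr c / R\<^sup>2"
      unfolding G_def using that(2)[OF w] R by (intro kernel_bound) auto
  qed auto
  have "contour_integral ?r G = contour_integral (linepath a1 a2) G + contour_integral (linepath a2 a3) G +
    contour_integral (linepath a3 a4) G + contour_integral (linepath a4 a1) G"
    using contour_integral_rectpath[OF contG] by (simp add: a1_def a2_def a3_def a4_def)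
  hence diff: "vert_integral c G R - contour_integral ?r G = - (contour_integral (linepath a1 a2) G +
      contour_integral (linepath a3 a4) G + contour_integral (linepath a4 a1) G)"
    by (simp add: vert_integral_def a2_def a3_def)
  have "norm (vert_integral c G R - contour_integral ?r G) \<le> norm (contour_integral (linepath a1 a2) G) +
      norm (contour_integral (linepath a3 a4) G) + norm (contour_integral (linepath a4 a1) G)"
    unfolding diff norm_minus_cancel by (intro order.trans[OF norm_triangle_ineq] add_mono order_refl norm_triangle_ineq)
  also have "\<dots> \<le> 2 * y powr c / R\<^sup>2 * norm (a2 - a1) + 2 * y powr c / R\<^sup>2 * norm (a4 - a3) +
      2 * y powr c / R\<^sup>2 * norm (a1 - a4)"
  proof (intro add_mono bound)
    fix w
    show "(R \<le> \<bar>Im w\<bar> \<or> R \<le> \<bar>Re w\<bar>) \<and> Re w \<le> c" if "w \<in> closed_segment a1 a2"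
      using that R c by (auto simp: a1_def a2_def closed_segment_same_Im closed_segment_eq_real_ivl)
    show "(R \<le> \<bar>Im w\<bar> \<or> R \<le> \<bar>Re w\<bar>) \<and> Re w \<le> c" if "w \<in> closed_segment a3 a4"
      using that R c by (auto simp: a3_def a4_def closed_segment_same_Im closed_segment_eq_real_ivl)
    show "(R \<le> \<bar>Im w\<bar> \<or> R \<le> \<bar>Re w\<bar>) \<and> Re w \<le> c" if "w \<in> closed_segment a4 a1"
      using that R c by (auto simp: a1_def a4_def closed_segment_same_Re)
  qed (auto simp: pi)
  \<comment> \<open>The three outer edges have lengths c + R, c + R and 2R, at most 6R together
    since c \<le> R.\<close>
  also have "\<dots> = 2 * y powr c / R\<^sup>2 * (2 * (c + R) + 2 * R)"
    using R c by (simp add: a1_def a2_def a3_def a4_def norm_Complex_diff algebra_simps add_divide_distrib)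
  also have "\<dots> \<le> 2 * y powr c / R\<^sup>2 * (6 * R)"
    using R c by (intro mult_left_mono) auto
  also have "\<dots> = 12 * y powr c / R" using R by (simp add: field_simps power2_eq_square)
  finally have "norm (vert_integral c G R - 2 * pi * \<i> * of_real (1 - 1 / y)) \<le> 12 * y powr c / R"
    unfolding ci .
  thus ?thesis unfolding G_def f_def .
qed

lemma perron_kernel_tendsto:
  assumes "1 \<le> y" "0 < c"
  shows "((\<lambda>R. vert_integral c (\<lambda>w. of_real y powr w / (w * (w + 1))) R) \<longlongrightarrow>
           2 * pi * \<i> * of_real (1 - 1 / y)) at_top"
proof (rule Lim_transform2[OF tendsto_const], rule Lim_null_comparison)
  show "\<forall>\<^sub>F R in at_top. norm (2 * pi * \<i> * of_real (1 - 1 / y) -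
      vert_integral c (\<lambda>w. of_real y powr w / (w * (w + 1))) R) \<le> 12 * y powr c / R"
    using eventually_ge_at_top[of "max 2 c"]
    by eventually_elim (subst norm_minus_commute, rule perron_kernel_rectangle, use assms in auto)
  show "((\<lambda>R. 12 * y powr c / R) \<longlongrightarrow> 0) at_top"
    by (intro tendsto_divide_0[OF tendsto_const] filterlim_at_top_imp_at_infinity filterlim_ident)
qed

text \<open>No sum is exchanged with a limit: the tail is treated as one function H, namely F(w) x^w
  minus the first N terms. It is holomorphic for Re w > 0, and for Re w \<ge> c it is the sum of the
  terms with x/(n+1) \<le> 1, whose moduli do not grow as Re w does. So H is bounded there and its
  integral vanishes in the limit; the N remaining terms are explicit kernels. The closed range of x
  lets x = N and x = N + 1 share the same finite sum, the term at an endpoint having weight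
  0.\<close>

lemma perron_finite:
  assumes c: "0 < c" and F: "F holomorphic_on half_plane 0"
    and abs: "summable (\<lambda>n. norm (b (Suc n)) * real (Suc n) powr (- c))"
    and rep: "\<And>w. c \<le> Re w \<Longrightarrow> ds_term b w sums F w"
    and x: "0 < x" "real N \<le> x" "x \<le> real (Suc N)"
  shows "((\<lambda>R. vert_integral c (\<lambda>w. F w * of_real x powr w / (w * (w + 1))) R) \<longlongrightarrow>
           2 * pi * \<i> * (\<Sum>n<N. b (Suc n) * of_real (1 - real (Suc n) / x))) at_top"
proof -
  define P where "P = (\<lambda>n w. of_real (x / real (Suc n)) powr w :: complex)"
  define H where "H = (\<lambda>w. F w * of_real x powr w - (\<Sum>n<N. b (Suc n) * P n w))"
  have termP: "ds_term b w n * of_real x powr w = b (Suc n) * P n w" for w n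
  proof -
    have "of_real (x / real (Suc n)) powr w = (of_real x powr w / of_nat (Suc n) powr w :: complex)"
    proof -
      have e: "of_real y powr w = exp (w * of_real (ln y))" if "y > 0" for y :: real
        using that by (simp add: powr_def Ln_of_real)
      have "of_real (x / real (Suc n)) powr w = exp (w * of_real (ln x) - w * of_real (ln (real (Suc n))))"
        using x e[of "x / real (Suc n)"] by (simp add: ln_div right_diff_distrib del: of_nat_Suc)
      also have "\<dots> = of_real x powr w / of_real (real (Suc n)) powr w"
        using x by (simp add: exp_diff e del: of_nat_Suc of_real_of_nat_eq)
      finally show ?thesis by simp
    qed
    thus ?thesis unfolding ds_term_def P_def by (simp add: powr_minus field_simps)
  qed
  have holP: "P n holomorphic_on A" for n A
    unfolding P_def by (intro holomorphic_intros)
  have holH: "H holomorphic_on half_plane 0"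
    unfolding H_def using x by (intro holomorphic_intros F holP) auto
  define B where "B = x powr c * (\<Sum>n. norm (b (Suc n)) * real (Suc n) powr (- c))"
  have boundH: "norm (H w) \<le> B" if w: "c \<le> Re w" for w
  proof -
    have "(\<lambda>n. b (Suc n) * P n w) sums (F w * of_real x powr w)"
      using sums_mult2[OF rep[OF w], of "of_real x powr w"] unfolding termP .
    hence HS: "(\<lambda>n. b (Suc (n + N)) * P (n + N) w) sums H w"
      using sums_split_initial_segment[of "\<lambda>n. b (Suc n) * P n w" _ N] by (simp add: H_def)
    have le: "norm (b (Suc (n + N)) * P (n + N) w) \<le>
        x powr c * (norm (b (Suc (n + N))) * real (Suc (n + N)) powr (- c))" for n
    proof -
      have "x / real (Suc (n + N)) \<le> 1" using x by simp
      have "norm (P (n + N) w) = (x / real (Suc (n + N))) powr Re w"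
        unfolding P_def using x by (subst norm_powr_real_powr) auto
      also have "\<dots> \<le> (x / real (Suc (n + N))) powr c"
        using \<open>x / real (Suc (n + N)) \<le> 1\<close> w x by (intro powr_mono') auto
      also have "\<dots> = x powr c * real (Suc (n + N)) powr (- c)"
        using x by (simp add: powr_divide powr_minus field_simps)
      finally show ?thesis unfolding norm_mult using mult_left_mono[OF _ norm_ge_zero[of "b (Suc (n + N))"]]
        by (fastforce simp: mult_ac)
    qed
    have sum': "summable (\<lambda>n. x powr c * (norm (b (Suc (n + N))) * real (Suc (n + N)) powr (- c)))"
      using summable_ignore_initial_segment[OF abs, of N] by (intro summable_mult) simp
    have "norm (H w) \<le> (\<Sum>n. x powr c * (norm (b (Suc (n + N))) * real (Suc (n + N)) powr (- c)))"
      by (rule norm_sums_le[OF HS summable_sums[OF sum'] le])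
    also have "\<dots> = x powr c * (\<Sum>n. norm (b (Suc (n + N))) * real (Suc (n + N)) powr (- c))"
      using summable_ignore_initial_segment[OF abs, of N] by (intro suminf_mult) simp
    also have "\<dots> \<le> B" unfolding B_def
    proof (rule mult_left_mono)
      show "(\<Sum>n. norm (b (Suc (n + N))) * real (Suc (n + N)) powr (- c))
         \<le> (\<Sum>n. norm (b (Suc n)) * real (Suc n) powr (- c))"
        using suminf_split_initial_segment[OF abs, of N] by (simp add: sum_nonneg)
    qed simp
    finally show ?thesis .
  qed
  let ?k = "\<lambda>w::complex. w * (w + 1)"
  have contP: "continuous_on {w. Re w = c} (\<lambda>w. P n w / ?k w)" for n
    by (rule continuous_on_kernel[OF holP c])
  have split: "vert_integral c (\<lambda>w. F w * of_real x powr w / ?k w) R =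
      vert_integral c (\<lambda>w. H w / ?k w) R + (\<Sum>n<N. b (Suc n) * vert_integral c (\<lambda>w. P n w / ?k w) R)" for R
  proof -
    have "(\<lambda>w. F w * of_real x powr w / ?k w) = (\<lambda>w. H w / ?k w + (\<Sum>n<N. b (Suc n) * (P n w / ?k w)))"
      by (simp add: H_def sum_divide_distrib diff_divide_distrib)
    moreover have iP: "(\<lambda>w. P n w / ?k w) contour_integrable_on linepath (Complex c (- R)) (Complex c R)" for n
      by (rule vert_integral_integrable[OF contP])
    have "contour_integral (linepath (Complex c (- R)) (Complex c R)) (\<lambda>w. H w / ?k w + (\<Sum>n<N. b (Suc n) * (P n w / ?k w))) =
      contour_integral (linepath (Complex c (- R)) (Complex c R)) (\<lambda>w. H w / ?k w) +
      contour_integral (linepath (Complex c (- R)) (Complex c R)) (\<lambda>w. \<Sum>n<N. b (Suc n) * (P n w / ?k w))"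
      by (intro contour_integral_add vert_integral_integrable continuous_on_kernel[OF holH c]
          contour_integrable_sum contour_integrable_lmul iP finite_lessThan)
    moreover have "contour_integral (linepath (Complex c (- R)) (Complex c R)) (\<lambda>w. \<Sum>n<N. b (Suc n) * (P n w / ?k w)) =
      (\<Sum>n<N. b (Suc n) * contour_integral (linepath (Complex c (- R)) (Complex c R)) (\<lambda>w. P n w / ?k w))"
      by (subst contour_integral_sum) (auto intro: contour_integrable_lmul iP simp only: contour_integral_lmul[OF iP] finite_lessThan)
    ultimately show ?thesis by (simp only: vert_integral_def)
  qed
  have "((\<lambda>R. vert_integral c (\<lambda>w. H w / ?k w) R + (\<Sum>n<N. b (Suc n) * vert_integral c (\<lambda>w. P n w / ?k w) R)) \<longlongrightarrow>
      0 + (\<Sum>n<N. b (Suc n) * (2 * pi * \<i> * of_real (1 - 1 / (x / real (Suc n)))))) at_top"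
    unfolding P_def
    by (intro tendsto_add tendsto_sum tendsto_mult tendsto_const perron_kernel_tendsto c
        vert_integral_tendsto_0[OF holH c boundH]) (use x in auto)
  also have "0 + (\<Sum>n<N. b (Suc n) * (2 * pi * \<i> * of_real (1 - 1 / (x / real (Suc n))))) =
     2 * pi * \<i> * (\<Sum>n<N. b (Suc n) * of_real (1 - real (Suc n) / x))"
    by (simp add: sum_distrib_left mult_ac)
  finally show ?thesis unfolding split .
qed

text \<open>Differencing the Riesz means \<open>\<Sum>n\<le>x. b n * (x - n)\<close> between consecutive integers
  recovers the plain partial sums, with a kernel that decays quadratically on vertical lines.\<close>

lemma perron_partial_sum:
  assumes c: "0 < c" and F: "F holomorphic_on half_plane 0"
    and abs: "summable (\<lambda>n. norm (b (Suc n)) * real (Suc n) powr (- c))"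
    and rep: "\<And>w. c \<le> Re w \<Longrightarrow> ds_term b w sums F w"
    and N: "0 < N"
  shows "((\<lambda>R. vert_integral c (\<lambda>w. F w * (of_nat (Suc N) powr (w + 1) - of_nat N powr (w + 1)) / (w * (w + 1))) R) \<longlongrightarrow>
           2 * pi * \<i> * (\<Sum>n<N. b (Suc n))) at_top"
proof -
  let ?k = "\<lambda>w::complex. w * (w + 1)"
  let ?V = "\<lambda>x R. vert_integral c (\<lambda>w. F w * of_real x powr w / ?k w) R"
  have "((\<lambda>R. of_nat (Suc N) * ?V (real (Suc N)) R - of_nat N * ?V (real N) R) \<longlongrightarrow>
      of_nat (Suc N) * (2 * pi * \<i> * (\<Sum>n<N. b (Suc n) * of_real (1 - real (Suc n) / real (Suc N)))) -
      of_nat N * (2 * pi * \<i> * (\<Sum>n<N. b (Suc n) * of_real (1 - real (Suc n) / real N)))) at_top"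
    by (intro tendsto_diff tendsto_mult tendsto_const perron_finite[OF c F abs rep]) (use N in auto)
  also have "of_nat (Suc N) * (2 * pi * \<i> * (\<Sum>n<N. b (Suc n) * of_real (1 - real (Suc n) / real (Suc N)))) -
      of_nat N * (2 * pi * \<i> * (\<Sum>n<N. b (Suc n) * of_real (1 - real (Suc n) / real N))) =
      2 * pi * \<i> * (\<Sum>n<N. of_nat (Suc N) * (b (Suc n) * of_real (1 - real (Suc n) / real (Suc N)))
        - of_nat N * (b (Suc n) * of_real (1 - real (Suc n) / real N)))"
    by (simp only: sum_subtractf sum_distrib_left[symmetric]) (simp add: algebra_simps)
  also have "(\<Sum>n<N. of_nat (Suc N) * (b (Suc n) * of_real (1 - real (Suc n) / real (Suc N)))
        - of_nat N * (b (Suc n) * of_real (1 - real (Suc n) / real N))) = (\<Sum>n<N. b (Suc n))"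
  proof (rule sum.cong[OF refl])
    fix n
    have *: "of_nat m * (u * of_real (1 - r / real m)) = u * (of_nat m - of_real r)"
      if "m > 0" for m :: nat and u :: complex and r
      using that by (simp add: field_simps)
    show "of_nat (Suc N) * (b (Suc n) * of_real (1 - real (Suc n) / real (Suc N)))
        - of_nat N * (b (Suc n) * of_real (1 - real (Suc n) / real N)) = b (Suc n)"
      unfolding *[OF N] *[OF zero_less_Suc] by (simp add: algebra_simps)
  qed
  also have "(\<lambda>R. of_nat (Suc N) * ?V (real (Suc N)) R - of_nat N * ?V (real N) R) =
     vert_integral c (\<lambda>w. F w * (of_nat (Suc N) powr (w + 1) - of_nat N powr (w + 1)) / (w * (w + 1)))"
  proof
    fix R
    have cont: "continuous_on {w. Re w = c} (\<lambda>w. F w * of_real x powr w / ?k w)" if "x > 0" for x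
      using that by (intro continuous_on_kernel[OF _ c] holomorphic_intros F) auto
    have "vert_integral c (\<lambda>w. F w * (of_nat (Suc N) powr (w + 1) - of_nat N powr (w + 1)) / ?k w) R =
      vert_integral c (\<lambda>w. of_nat (Suc N) * (F w * of_real (real (Suc N)) powr w / ?k w) -
        of_nat N * (F w * of_real (real N) powr w / ?k w)) R"
      using N by (intro arg_cong[of _ _ "\<lambda>G. vert_integral c G R"] ext)
        (simp add: powr_add diff_divide_distrib ring_distribs mult_ac del: of_nat_Suc)
    also have "\<dots> = of_nat (Suc N) * ?V (real (Suc N)) R - of_nat N * ?V (real N) R"
    proof -
      have int: "(\<lambda>w. F w * of_real x powr w / ?k w) contour_integrable_on linepath (Complex c (- R)) (Complex c R)"
        if "x > 0" for x
        using vert_integral_integrable[OF cont[OF that]] .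
      have i1: "(\<lambda>w. F w * of_real (real (Suc N)) powr w / ?k w) contour_integrable_on linepath (Complex c (- R)) (Complex c R)"
        and i2: "(\<lambda>w. F w * of_real (real N) powr w / ?k w) contour_integrable_on linepath (Complex c (- R)) (Complex c R)"
        using int[of "real (Suc N)"] int[of "real N"] N by auto
      show ?thesis
        unfolding vert_integral_def
        using contour_integral_diff[OF contour_integrable_lmul[OF i1] contour_integrable_lmul[OF i2]]
          contour_integral_lmul[OF i1] contour_integral_lmul[OF i2] by simp
    qed
    finally show "of_nat (Suc N) * ?V (real (Suc N)) R - of_nat N * ?V (real N) R =
       vert_integral c (\<lambda>w. F w * (of_nat (Suc N) powr (w + 1) - of_nat N powr (w + 1)) / ?k w) R" ..
  qed
  finally show ?thesis .
qed

text \<open>Passing from height 2^K to 2^(K+1) adds two segments of length 2^K on which the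
  integrand is at most A 2^(-K(1+\<kappa>)), so each contributes at most A 2^(-\<kappa> K). The
  geometric sum makes the bound uniform in K; heights 2^K suffice because the limit in R is already
  known to exist when this is applied.\<close>

lemma vert_integral_dyadic_bound:
  assumes cont: "continuous_on {w. Re w = c} G" and \<kappa>: "0 < \<kappa>" and A: "0 \<le> A"
    and near: "\<And>w. Re w = c \<Longrightarrow> norm (G w) \<le> A"
    and far: "\<And>w. Re w = c \<Longrightarrow> 1 \<le> \<bar>Im w\<bar> \<Longrightarrow> norm (G w) \<le> A * \<bar>Im w\<bar> powr (- 1 - \<kappa>)"
  shows "norm (vert_integral c G (2 ^ K)) \<le> 2 * A * (1 + (\<Sum>k<K. (2 powr - \<kappa>) ^ k))"
proof (induction K)
  case 0
  show ?case using vert_integral_bound[OF cont, of 1 A] near A by simp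
next
  case (Suc K)
  let ?r = "2 ^ K :: real"
  have powr: "?r powr (- 1 - \<kappa>) * ?r = (2 powr - \<kappa>) ^ K"
  proof -
    have "?r powr (- 1 - \<kappa>) * ?r = ?r powr (- 1 - \<kappa>) * ?r powr 1" by simp
    also have "\<dots> = ?r powr (- \<kappa>)" by (subst powr_add[symmetric]) simp
    also have "\<dots> = (2 powr - \<kappa>) ^ K" by (simp add: powr_power powr_realpow[symmetric] powr_powr mult.commute)
    finally show ?thesis .
  qed
  have piece: "norm (contour_integral (linepath (Complex c u) (Complex c v)) G) \<le> A * (2 powr - \<kappa>) ^ K"
    if "v - u = ?r" "u = ?r \<or> v = - ?r" for u v
  proof -
    have "norm (contour_integral (linepath (Complex c u) (Complex c v)) G)
      \<le> (A * ?r powr (- 1 - \<kappa>)) * norm (Complex c v - Complex c u)"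
    proof (rule contour_integral_bound_linepath[OF vert_integral_integrable[OF cont]])
      fix w assume w: "w \<in> closed_segment (Complex c u) (Complex c v)"
      have "u \<le> v" using that by (metis diff_ge_0_iff_ge zero_le_power zero_le_numeral)
      hence "Im w \<in> {u..v}" using w
        by (simp add: closed_segment_same_Re closed_segment_eq_real_ivl)
      hence Im: "?r \<le> \<bar>Im w\<bar>" using that by auto
      have "1 \<le> \<bar>Im w\<bar>" using Im one_le_power[of "2::real" K] by linarith
      hence "norm (G w) \<le> A * \<bar>Im w\<bar> powr (- 1 - \<kappa>)"
        using far[of w] closed_segment_vertical[OF w] by blast
      also have "\<dots> \<le> A * ?r powr (- 1 - \<kappa>)"
        using A \<kappa> Im by (intro mult_left_mono powr_mono2') auto
      finally show "norm (G w) \<le> A * ?r powr (- 1 - \<kappa>)" .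
    qed (use A in auto)
    also have "norm (Complex c v - Complex c u) = ?r"
      using that by (simp add: norm_Complex_diff)
    also have "A * ?r powr (- 1 - \<kappa>) * ?r = A * (2 powr - \<kappa>) ^ K"
      by (simp only: mult.assoc powr)
    finally show ?thesis .
  qed
  have cs: "continuous_on (closed_segment (Complex c u) (Complex c v)) G" for u v
    by (rule continuous_on_subset[OF cont]) (auto dest: closed_segment_vertical)
  have mem: "Complex c t \<in> closed_segment (Complex c u) (Complex c v)" if "u \<le> t" "t \<le> v" for t u v
    using that by (simp add: closed_segment_same_Re closed_segment_eq_real_ivl)
  have "vert_integral c G (2 ^ Suc K) =
     contour_integral (linepath (Complex c (- (2 ^ Suc K))) (Complex c (- ?r))) G +
     (vert_integral c G ?r + contour_integral (linepath (Complex c ?r) (Complex c (2 ^ Suc K))) G)"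
    unfolding vert_integral_def
    using contour_integral_split_linepath[OF cs mem, of "- (2 ^ Suc K)" "- ?r" "2 ^ Suc K"]
      contour_integral_split_linepath[OF cs mem, of "- ?r" ?r "2 ^ Suc K"]
    by simp
  also have "norm \<dots> \<le> A * (2 powr - \<kappa>) ^ K + (2 * A * (1 + (\<Sum>k<K. (2 powr - \<kappa>) ^ k)) + A * (2 powr - \<kappa>) ^ K)"
    by (intro order.trans[OF norm_triangle_ineq] add_mono Suc.IH piece) auto
  also have "\<dots> = 2 * A * (1 + (\<Sum>k<Suc K. (2 powr - \<kappa>) ^ k))" by (simp add: algebra_simps)
  finally show ?case .
qed

section \<open>Bohr's theorem\<close>

text \<open>The mean value bound saves one power of N but grows with \<open>norm (w + 1)\<close>;
  the triangle inequality is uniform in Im w but loses that power. Neither suffices alone.\<close>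

lemma powr_difference_bounds:
  fixes w :: complex and N :: nat
  assumes "0 < N" "0 < Re w"
  defines "D \<equiv> of_nat (Suc N) powr (w + 1) - of_nat N powr (w + 1)"
  shows "norm D \<le> norm (w + 1) * real (Suc N) powr Re w"
    and "norm D \<le> 2 * real (Suc N) powr (Re w + 1)"
proof -
  have "norm (of_real (real (Suc N)) powr (w + 1) - of_real (real N) powr (w + 1))
      \<le> norm (w + 1) * real (Suc N) powr Re w * (real (Suc N) - real N)"
    by (rule powr_diff_bound) (use assms in \<open>auto intro!: powr_mono2\<close>)
  thus "norm D \<le> norm (w + 1) * real (Suc N) powr Re w" by (simp add: D_def)
  have "norm (of_nat N powr (w + 1)) = real N powr (Re w + 1)"
    using assms norm_powr_real_powr[of "of_nat N" "w + 1"] by simp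
  also have "\<dots> \<le> real (Suc N) powr (Re w + 1)" using assms by (intro powr_mono2) auto
  finally show "norm D \<le> 2 * real (Suc N) powr (Re w + 1)"
    unfolding D_def using norm_nat_powr[of N "w + 1"]
    by (intro order.trans[OF norm_triangle_ineq4]) simp
qed

text \<open>The geometric mean of the two numerator bounds, with weights 1 - \<kappa> and \<kappa>.
  The exponents of N + 1 add up to \<kappa>(1 - \<kappa>) + (\<kappa> + 1)\<kappa> = 2\<kappa>, and
  after division by w(w+1) a decay \<bar>Im w\<bar>^(-1-\<kappa>) remains, just enough for
  integrability. The first bound alone would leave only 1/\<bar>w\<bar>; the second alone would cost
  N^(1+\<kappa>).\<close>

lemma perron_kernel_interpolation:
  fixes w :: complex and N :: nat
  assumes N: "0 < N" and \<kappa>: "0 < \<kappa>" "\<kappa> < 1" and w: "Re w = \<kappa>" and z: "norm z \<le> M"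
  defines "G \<equiv> z * (of_nat (Suc N) powr (w + 1) - of_nat N powr (w + 1)) / (w * (w + 1))"
  defines "A \<equiv> 2 * M / \<kappa> * real (Suc N) powr (2 * \<kappa>)"
  shows "norm G \<le> A" and "1 \<le> \<bar>Im w\<bar> \<Longrightarrow> norm G \<le> A * \<bar>Im w\<bar> powr (- 1 - \<kappa>)"
proof -
  define L d where "L = real (Suc N)" and "d = norm (of_nat (Suc N) powr (w + 1) - of_nat N powr (w + 1) :: complex)"
  have L: "L \<ge> 1" by (simp add: L_def)
  have M: "M \<ge> 0" using order.trans[OF norm_ge_zero z] .
  have d1: "d \<le> norm (w + 1) * L powr \<kappa>" and d2: "d \<le> 2 * L powr (\<kappa> + 1)"
    using powr_difference_bounds[OF N, of w] \<kappa> w by (simp_all add: L_def d_def)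
  have w0: "norm w \<ge> \<kappa>" using abs_Re_le_cmod[of w] w \<kappa> by simp
  have w1: "norm (w + 1) > 0" using w \<kappa> by (auto simp: complex_eq_iff)
  have G: "norm G = norm z * (d / (norm w * norm (w + 1)))"
    by (simp add: G_def d_def norm_mult norm_divide)
  have "d / (norm w * norm (w + 1)) \<le> (norm (w + 1) * L powr \<kappa>) / (\<kappa> * norm (w + 1))"
    using d1 w0 w1 \<kappa> by (intro frac_le mult_right_mono) auto
  also have "\<dots> = L powr \<kappa> / \<kappa>" using w1 by simp
  also have "\<dots> \<le> 2 * L powr (2 * \<kappa>) / \<kappa>"
  proof (rule divide_right_mono)
    have "L powr \<kappa> \<le> L powr (2 * \<kappa>)" using L \<kappa> by (intro powr_mono) auto
    thus "L powr \<kappa> \<le> 2 * L powr (2 * \<kappa>)" using powr_ge_zero[of L "2 * \<kappa>"] by linarith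
  qed (use \<kappa> in auto)
  finally have "norm G \<le> M * (2 * L powr (2 * \<kappa>) / \<kappa>)"
    unfolding G using z M by (intro mult_mono) (auto simp: d_def)
  thus "norm G \<le> A" by (simp add: A_def L_def mult_ac)
  assume t: "1 \<le> \<bar>Im w\<bar>"
  define t where "t = \<bar>Im w\<bar>"
  have tw: "t \<le> norm w" "t \<le> norm (w + 1)" "1 \<le> t"
    using abs_Im_le_cmod[of w] abs_Im_le_cmod[of "w + 1"] t by (auto simp: t_def)
  have "d \<le> norm (w + 1) powr (1 - \<kappa>) * (2 * L powr (2 * \<kappa>))"
  proof (cases "d = 0")
    case False
    hence d0: "d > 0" by (simp add: d_def)
    have "d = d powr (1 - \<kappa>) * d powr \<kappa>" using d0 by (simp flip: powr_add)
    also have "\<dots> \<le> (norm (w + 1) * L powr \<kappa>) powr (1 - \<kappa>) * (2 * L powr (\<kappa> + 1)) powr \<kappa>"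
      using d0 d1 d2 \<kappa> by (intro mult_mono powr_mono2) auto
    also have "\<dots> = norm (w + 1) powr (1 - \<kappa>) * (2 powr \<kappa> * (L powr (\<kappa> * (1 - \<kappa>)) * L powr ((\<kappa> + 1) * \<kappa>)))"
      using w1 L by (simp add: powr_mult powr_powr)
    also have "L powr (\<kappa> * (1 - \<kappa>)) * L powr ((\<kappa> + 1) * \<kappa>) = L powr (2 * \<kappa>)"
      by (simp flip: powr_add) (simp add: algebra_simps)
    also have "norm (w + 1) powr (1 - \<kappa>) * (2 powr \<kappa> * L powr (2 * \<kappa>))
       \<le> norm (w + 1) powr (1 - \<kappa>) * (2 * L powr (2 * \<kappa>))"
      using \<kappa> powr_mono[of \<kappa> 1 2] by (intro mult_left_mono mult_right_mono) auto
    finally show ?thesis .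
  qed auto
  hence "d / (norm w * norm (w + 1)) \<le> norm (w + 1) powr (1 - \<kappa>) * (2 * L powr (2 * \<kappa>)) / (norm w * norm (w + 1))"
    by (intro divide_right_mono) auto
  also have "\<dots> = 2 * L powr (2 * \<kappa>) * (inverse (norm w) * norm (w + 1) powr (- \<kappa>))"
    using w1 by (simp add: powr_diff powr_minus field_simps)
  also have "\<dots> \<le> 2 * L powr (2 * \<kappa>) * (inverse t * t powr (- \<kappa>))"
    using tw \<kappa> by (intro mult_left_mono mult_mono powr_mono2' le_imp_inverse_le) auto
  also have "inverse t * t powr (- \<kappa>) = t powr (- 1 - \<kappa>)"
    using tw by (simp add: powr_diff powr_minus field_simps)
  finally have "norm G \<le> M * (2 * L powr (2 * \<kappa>) * t powr (- 1 - \<kappa>))"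
    unfolding G using z M by (intro mult_mono) (auto simp: d_def)
  \<comment> \<open>The factor 1/\<kappa> > 1 is inserted so that the same A serves both bounds; in
    the first it comes from \<open>norm w \<ge> \<kappa>\<close>.\<close>
  also have "\<dots> = (2 * M * L powr (2 * \<kappa>) * t powr (- 1 - \<kappa>)) * 1" by simp
  also have "\<dots> \<le> (2 * M * L powr (2 * \<kappa>) * t powr (- 1 - \<kappa>)) * (1 / \<kappa>)"
    using M \<kappa> by (intro mult_left_mono) auto
  finally show "norm G \<le> A * \<bar>Im w\<bar> powr (- 1 - \<kappa>)"
    by (simp add: A_def L_def t_def mult_ac)
qed

text \<open>Perron's formula holds on the line Re w = c, where the series converges absolutely. On
  the strip \<kappa> \<le> Re w \<le> c the numerator H is bounded for fixed N, so the line may be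
  moved to Re w = \<kappa>; there only \<open>norm (F w) \<le> M\<close> enters, and the constant no
  longer depends on N.\<close>

lemma partial_sum_bound:
  assumes F: "F holomorphic_on half_plane 0" and M: "\<And>w. 0 < Re w \<Longrightarrow> norm (F w) \<le> M"
    and abs: "summable (\<lambda>n. norm (b (Suc n)) * real (Suc n) powr (- c))"
    and rep: "\<And>w. c \<le> Re w \<Longrightarrow> ds_term b w sums F w"
    and \<kappa>: "0 < \<kappa>" "\<kappa> < 1" "\<kappa> \<le> c"
  shows "\<exists>C. \<forall>N. norm (\<Sum>n<N. b (Suc n)) \<le> C * real (Suc N) powr (2 * \<kappa>)"
proof -
  have c: "0 < c" using \<kappa> by simp
  have M0: "M \<ge> 0" using order.trans[OF norm_ge_zero M[of 1]] by simp
  define q where "q = (2::real) powr - \<kappa>"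
  have q: "0 < q" "q < 1" using \<kappa> by (auto simp: q_def powr_less_one)
  define C where "C = 2 * M / \<kappa> * (1 + 1 / (1 - q))"
  have "norm (\<Sum>n<N. b (Suc n)) \<le> C * real (Suc N) powr (2 * \<kappa>)" for N
  proof (cases "N = 0")
    case True
    thus ?thesis using M0 \<kappa> q by (simp add: C_def)
  next
    case False
    hence N: "N > 0" by simp
    define H where "H = (\<lambda>w. F w * (of_nat (Suc N) powr (w + 1) - of_nat N powr (w + 1)))"
    let ?G = "\<lambda>w. H w / (w * (w + 1))"
    define A where "A = 2 * M / \<kappa> * real (Suc N) powr (2 * \<kappa>)"
    have holH: "H holomorphic_on half_plane 0"
      unfolding H_def using N by (intro holomorphic_intros F) auto
    have boundH: "norm (H w) \<le> M * (2 * real (Suc N) powr (c + 1))" if "Re w \<in> {\<kappa>..c}" for w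
    proof -
      have "norm (of_nat (Suc N) powr (w + 1) - of_nat N powr (w + 1)) \<le> 2 * real (Suc N) powr (Re w + 1)"
        using powr_difference_bounds(2)[OF N, of w] that \<kappa> by auto
      also have "\<dots> \<le> 2 * real (Suc N) powr (c + 1)"
        using that by (intro mult_left_mono powr_mono) auto
      finally show ?thesis
        unfolding H_def norm_mult using M[of w] M0 that \<kappa> by (intro mult_mono) auto
    qed
    have "(vert_integral c ?G \<longlongrightarrow> 2 * pi * \<i> * (\<Sum>n<N. b (Suc n))) at_top"
      unfolding H_def using perron_partial_sum[OF c F abs rep N] .
    from tendsto_add[OF this vert_integral_shift[OF holH \<kappa>(1,3) boundH]]
    have "(vert_integral \<kappa> ?G \<longlongrightarrow> 2 * pi * \<i> * (\<Sum>n<N. b (Suc n))) at_top" by simp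
    moreover have "filterlim (\<lambda>K::nat. 2 ^ K :: real) at_top sequentially"
      using filterlim_realpow_sequentially_gt1[of "2::real"] by (simp add: filterlim_at_infinity_conv_norm_at_top)
    ultimately have "(\<lambda>K. vert_integral \<kappa> ?G (2 ^ K)) \<longlonglongrightarrow> 2 * pi * \<i> * (\<Sum>n<N. b (Suc n))"
      by (rule filterlim_compose)
    hence lim: "(\<lambda>K. norm (vert_integral \<kappa> ?G (2 ^ K))) \<longlonglongrightarrow> norm (2 * pi * \<i> * (\<Sum>n<N. b (Suc n)))"
      by (rule tendsto_norm)
    have "norm (vert_integral \<kappa> ?G (2 ^ K)) \<le> 2 * A * (1 + 1 / (1 - q))" for K
    proof -
      have "norm (vert_integral \<kappa> ?G (2 ^ K)) \<le> 2 * A * (1 + (\<Sum>k<K. (2 powr - \<kappa>) ^ k))"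
      proof (rule vert_integral_dyadic_bound[OF continuous_on_kernel[OF holH]])
        show "A \<ge> 0" using M0 \<kappa> by (simp add: A_def)
        fix w :: complex assume w: "Re w = \<kappa>"
        hence Mw: "norm (F w) \<le> M" using M[of w] \<kappa> by simp
        note * = perron_kernel_interpolation[OF N \<kappa>(1,2) w Mw]
        show "norm (?G w) \<le> A" unfolding H_def A_def by (rule *(1))
        show "norm (?G w) \<le> A * \<bar>Im w\<bar> powr (- 1 - \<kappa>)" if "1 \<le> \<bar>Im w\<bar>"
          unfolding H_def A_def by (rule *(2)[OF that])
      qed (use \<kappa> in auto)
      also have "2 * A * (1 + (\<Sum>k<K. (2 powr - \<kappa>) ^ k)) \<le> 2 * A * (1 + 1 / (1 - q))"
      proof -
        have "(\<Sum>k<K. q ^ k) \<le> (\<Sum>k. q ^ k)"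
          using q by (intro sum_le_suminf summable_geometric) auto
        hence "(\<Sum>k<K. (2 powr - \<kappa>) ^ k) \<le> 1 / (1 - q)"
          using q by (simp add: suminf_geometric q_def)
        moreover have "A \<ge> 0" using M0 \<kappa> by (simp add: A_def)
        ultimately show ?thesis by (intro mult_left_mono add_left_mono) auto
      qed
      finally show ?thesis .
    qed
    from LIMSEQ_le_const2[OF lim, of "2 * A * (1 + 1 / (1 - q))"] this
    have "2 * pi * norm (\<Sum>n<N. b (Suc n)) \<le> 2 * A * (1 + 1 / (1 - q))"
      by (auto simp: norm_mult)
    moreover have "2 * norm (\<Sum>n<N. b (Suc n)) \<le> 2 * pi * norm (\<Sum>n<N. b (Suc n))"
      using pi_gt3 by (intro mult_right_mono) auto
    ultimately have "norm (\<Sum>n<N. b (Suc n)) \<le> A * (1 + 1 / (1 - q))" by simp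
    thus ?thesis by (simp only: A_def C_def mult_ac)
  qed
  thus ?thesis by blast
qed

section \<open>From partial sums of coefficients to convergence\<close>

lemma summation_by_parts_ds:
  fixes b :: dirichlet_series and s :: complex
  defines "S \<equiv> \<lambda>N. \<Sum>n<N. b (Suc n)"
  shows "(\<Sum>n<N. ds_term b s n) = S N * of_nat (Suc N) powr (-s) +
     (\<Sum>n<N. S (Suc n) * (of_nat (Suc n) powr (-s) - of_nat (Suc (Suc n)) powr (-s)))"
proof (induction N)
  case (Suc N)
  have "S (Suc N) = S N + b (Suc N)" by (simp add: S_def)
  thus ?case unfolding sum.lessThan_Suc Suc.IH by (simp add: ds_term_def algebra_simps del: of_nat_Suc)
qed (simp add: S_def)

text \<open>The Dirichlet series need not converge absolutely, but its Abel-summed form does,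
  locally uniformly, and the boundary term tends to 0. Convergence and holomorphy are therefore read
  off the transformed series.\<close>

lemma ds_of_partial_sum_bound:
  fixes b :: dirichlet_series
  defines "S \<equiv> \<lambda>N. \<Sum>n<N. b (Suc n)"
  assumes bound: "\<And>\<kappa>. 0 < \<kappa> \<Longrightarrow> \<exists>C. \<forall>N. norm (S N) \<le> C * real (Suc N) powr \<kappa>"
  shows "\<forall>s\<in>half_plane 0. ds_converges b s" and "ds_sum b holomorphic_on half_plane 0"
proof -
  define f where "f = (\<lambda>n s. S (Suc n) * (of_nat (Suc n) powr (-s) - of_nat (Suc (Suc n)) powr (-s)) :: complex)"
  have diff: "f n field_differentiable (at x)" for n x
  proof -
    have "f n holomorphic_on UNIV" unfolding f_def by (intro holomorphic_intros)
    thus ?thesis by (simp add: holomorphic_on_def)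
  qed
  have dom: "\<exists>d h. 0 < d \<and> summable h \<and> range h \<subseteq> \<real>\<^sub>\<ge>\<^sub>0 \<and>
      (\<forall>\<^sub>F n in sequentially. \<forall>y\<in>ball x d \<inter> half_plane 0. cmod (f n y) \<le> cmod (h n :: complex))"
    if x: "x \<in> half_plane 0" for x
  proof -
    \<comment> \<open>On the ball of radius d one has Re y \<ge> d. Differences of n^(-y) decay like
      n^(-d-1); allowing the partial sums growth n^(d/2) leaves the summable majorant
      n^(-1-d/2).\<close>
    define d where "d = Re x / 2"
    have d: "d > 0" using x by (simp add: d_def)
    obtain C where C: "\<And>N. norm (S N) \<le> C * real (Suc N) powr (d / 2)" using bound[of "d / 2"] d by auto
    have C0: "C \<ge> 0" using order.trans[OF norm_ge_zero C[of 0]] by simp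
    define K where "K = C * 2 powr (d / 2) * (norm x + d)"
    have K0: "K \<ge> 0" using C0 d by (simp add: K_def)
    define h where "h = (\<lambda>n. of_real (K * real (Suc n) powr (-1 - d / 2)) :: complex)"
    have "summable (\<lambda>n. real (Suc n) powr (-1 - d / 2))"
      using summable_real_powr_iff[of "-1 - d / 2"] d by (subst summable_Suc_iff) simp
    hence "summable h" unfolding h_def summable_complex_of_real by (intro summable_mult)
    moreover have "range h \<subseteq> \<real>\<^sub>\<ge>\<^sub>0" using K0 by (auto simp: h_def)
    moreover have "cmod (f n y) \<le> cmod (h n)" if y: "y \<in> ball x d" for n y
    proof -
      have nxy: "norm (x - y) < d" using y by (simp add: dist_norm)
      have "Re x - Re y \<le> norm (x - y)" using complex_Re_le_cmod[of "x - y"] by simp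
      hence Rey: "Re y \<ge> d" using nxy by (simp add: d_def)
      have ny: "norm y \<le> norm x + d" using nxy norm_triangle_ineq2[of y x] by (simp add: norm_minus_commute)
      have S: "norm (S (Suc n)) \<le> C * (2 powr (d / 2) * real (Suc n) powr (d / 2))"
      proof -
        have "real (Suc (Suc n)) powr (d / 2) \<le> (2 * real (Suc n)) powr (d / 2)"
          using d by (intro powr_mono2) auto
        also have "\<dots> = 2 powr (d / 2) * real (Suc n) powr (d / 2)" by (subst powr_mult) auto
        finally show ?thesis using order.trans[OF C mult_left_mono[OF _ C0]] by blast
      qed
      have "norm (of_real (real (Suc (Suc n))) powr (-y) - of_real (real (Suc n)) powr (-y))
         \<le> norm (-y) * real (Suc n) powr (-d - 1) * (real (Suc (Suc n)) - real (Suc n))"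
      proof (rule powr_diff_bound)
        fix t assume t: "t \<in> {real (Suc n)..real (Suc (Suc n))}"
        have "t powr (Re (-y) - 1) \<le> t powr (-d - 1)" using t Rey by (intro powr_mono) auto
        also have "\<dots> \<le> real (Suc n) powr (-d - 1)" using t d by (intro powr_mono2') auto
        finally show "t powr (Re (-y) - 1) \<le> real (Suc n) powr (-d - 1)" .
      qed auto
      hence D: "norm (of_nat (Suc n) powr (-y) - of_nat (Suc (Suc n)) powr (-y)) \<le> norm y * real (Suc n) powr (-d - 1)"
        by (simp add: norm_minus_commute)
      also have "\<dots> \<le> (norm x + d) * real (Suc n) powr (-d - 1)" using ny by (intro mult_right_mono) auto
      finally have "norm (f n y) \<le> C * (2 powr (d / 2) * real (Suc n) powr (d / 2)) * ((norm x + d) * real (Suc n) powr (-d - 1))"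
        unfolding f_def norm_mult using S C0 by (intro mult_mono) auto
      also have "\<dots> = K * (real (Suc n) powr (d / 2) * real (Suc n) powr (-d - 1))" by (simp add: K_def mult_ac)
      also have "real (Suc n) powr (d / 2) * real (Suc n) powr (-d - 1) = real (Suc n) powr (-1 - d / 2)"
        by (subst powr_add[symmetric], rule arg_cong2[where f = "(powr)"]) (simp_all add: field_simps)
      also have "K * real (Suc n) powr (-1 - d / 2) = norm (h n)"
        unfolding h_def norm_of_real using K0 by (simp del: of_nat_Suc)
      finally show ?thesis .
    qed
    ultimately show ?thesis using d by (intro exI[of _ d] exI[of _ h]) auto
  qed
  obtain g where g: "\<And>s. s \<in> half_plane 0 \<Longrightarrow> (\<lambda>n. f n s) sums g s"
    and gd: "\<And>s. s \<in> half_plane 0 \<Longrightarrow> g field_differentiable (at s)"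
    by (rule series_differentiable_comparison_complex[of "half_plane 0" f, OF half_plane_simps(2) diff dom]) blast+
  have main: "ds_term b s sums g s" if s: "s \<in> half_plane 0" for s
  proof -
    obtain C where C: "\<And>N. norm (S N) \<le> C * real (Suc N) powr (Re s / 2)" using bound[of "Re s / 2"] s by auto
    have "(\<lambda>N. S N * of_nat (Suc N) powr (-s)) \<longlonglongrightarrow> 0"
    proof (rule Lim_null_comparison)
      have "norm (S N * of_nat (Suc N) powr (-s)) \<le> C * real (Suc N) powr (- (Re s / 2))" for N
      proof -
        have "norm (S N * of_nat (Suc N) powr (-s)) \<le> C * real (Suc N) powr (Re s / 2) * real (Suc N) powr (- Re s)"
          unfolding norm_mult norm_nat_powr
          by (intro mult_mono) (use C[of N] order.trans[OF norm_ge_zero C[of N]] in \<open>auto simp del: of_nat_Suc\<close>)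
        also have "\<dots> = C * real (Suc N) powr (- (Re s / 2))"
          unfolding mult.assoc by (subst powr_add[symmetric]) simp
        finally show ?thesis .
      qed
      thus "\<forall>\<^sub>F N in sequentially. norm (S N * of_nat (Suc N) powr (-s)) \<le> C * real (Suc N) powr (- (Re s / 2))"
        by simp
      have "(\<lambda>N. real (Suc N) powr (- (Re s / 2))) \<longlonglongrightarrow> 0"
        using s by (intro tendsto_neg_powr filterlim_compose[OF filterlim_real_sequentially filterlim_Suc]) auto
      from tendsto_mult_right_zero[OF this, of C]
      show "(\<lambda>N. C * real (Suc N) powr (- (Re s / 2))) \<longlonglongrightarrow> 0" .
    qed
    from tendsto_add[OF this g[OF s, unfolded sums_def]]
    show ?thesis unfolding sums_def summation_by_parts_ds f_def S_def by (simp only: add_0)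
  qed
  thus "\<forall>s\<in>half_plane 0. ds_converges b s" by (auto simp: ds_converges_def sums_iff)
  have "g holomorphic_on half_plane 0"
    using gd by (auto simp: holomorphic_on_def field_differentiable_at_within)
  moreover have "ds_sum b s = g s" if "s \<in> half_plane 0" for s
    using main[OF that] by (simp add: ds_sum_def sums_iff)
  ultimately show "ds_sum b holomorphic_on half_plane 0"
    by (metis (no_types, lifting) holomorphic_transform)
qed

text \<open>The bound M is used for the partial sums, which give convergence for Re s > 0. The
  identity theorem then identifies the sum with F there, and so carries M over to the sum.\<close>

theorem bohr_H_inf:
  assumes F: "F holomorphic_on half_plane 0" and M: "\<And>w. 0 < Re w \<Longrightarrow> norm (F w) \<le> M"
    and abs: "summable (\<lambda>n. norm (b (Suc n)) * real (Suc n) powr (- c))"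
    and rep: "\<And>w. c \<le> Re w \<Longrightarrow> ds_term b w sums F w"
  shows "b \<in> H_inf"
proof -
  \<comment> \<open>A larger abscissa preserves absolute summability and guarantees
    \<open>\<kappa>' \<le> c'\<close> for every \<open>\<kappa>' \<le> 1/2\<close>, as the contour
    shift requires.\<close>
  define c' where "c' = max c 1"
  have abs': "summable (\<lambda>n. norm (b (Suc n)) * real (Suc n) powr (- c'))"
    by (rule summable_comparison_test'[OF abs, of 0]) (auto simp: c'_def intro!: mult_left_mono powr_mono)
  have bound: "\<exists>C. \<forall>N. norm (\<Sum>n<N. b (Suc n)) \<le> C * real (Suc N) powr \<kappa>" if \<kappa>: "0 < \<kappa>" for \<kappa>
  proof -
    define \<kappa>' where "\<kappa>' = min (\<kappa> / 2) (1 / 2)"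
    have "\<exists>C. \<forall>N. norm (\<Sum>n<N. b (Suc n)) \<le> C * real (Suc N) powr (2 * \<kappa>')"
      by (rule partial_sum_bound[OF F M abs' rep]) (use \<kappa> in \<open>auto simp: \<kappa>'_def c'_def\<close>)
    then obtain C where C: "norm (\<Sum>n<N. b (Suc n)) \<le> C * real (Suc N) powr (2 * \<kappa>')" for N by blast
    have C0: "C \<ge> 0" using order.trans[OF norm_ge_zero C[of 0]] by simp
    have "C * real (Suc N) powr (2 * \<kappa>') \<le> C * real (Suc N) powr \<kappa>" for N
      using C0 by (intro mult_left_mono powr_mono) (auto simp: \<kappa>'_def)
    thus ?thesis using C order.trans by meson
  qed
  note conv = ds_of_partial_sum_bound[OF bound]
  have eq: "ds_sum b s = F s" if s: "s \<in> half_plane 0" for s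
  proof (rule half_plane_identity[where c = c and f = "ds_sum b" and g = F])
    show "ds_sum b z = F z" if "c < Re z" for z
      using rep[of z] that by (auto simp: ds_sum_def sums_iff)
  qed (use conv F s in auto)
  have "bounded (ds_sum b ` half_plane 0)"
    unfolding bounded_iff using eq M by (intro exI[of _ M]) auto
  thus ?thesis using conv by (simp add: H_inf_def)
qed

section \<open>Absolutely convergent Dirichlet series as a Banach algebra\<close>

text \<open>N bounds the weighted \<ell>^1 norm at abscissa \<sigma>, and G is the sum on Re s \<ge>
  \<sigma>. The coefficients are hidden behind an existential, so the algebra operations can be
  tracked through G and N alone; unordered sums make regrouping possible.\<close>

definition ds_rep :: "real \<Rightarrow> real \<Rightarrow> (complex \<Rightarrow> complex) \<Rightarrow> bool" where
  "ds_rep \<sigma> N G \<longleftrightarrow> (\<exists>b :: nat \<Rightarrow> complex.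
     (\<lambda>n. norm (b n) * real n powr - \<sigma>) summable_on {0<..} \<and>
     (\<Sum>\<^sub>\<infinity>n\<in>{0<..}. norm (b n) * real n powr - \<sigma>) \<le> N \<and>
     (\<forall>s. \<sigma> \<le> Re s \<longrightarrow> ((\<lambda>n. b n * of_nat n powr - s) has_sum G s) {0<..}))"

lemma ds_rep_mono: "ds_rep \<sigma> N G \<Longrightarrow> N \<le> N' \<Longrightarrow> ds_rep \<sigma> N' G"
  unfolding ds_rep_def by (meson order.trans)

lemma ds_rep_cong: "ds_rep \<sigma> N G \<Longrightarrow> (\<And>s. \<sigma> \<le> Re s \<Longrightarrow> G s = G' s) \<Longrightarrow> ds_rep \<sigma> N G'"
  unfolding ds_rep_def by simp

lemma norm_pos_nat_powr: "0 < n \<Longrightarrow> norm (of_nat n powr s :: complex) = real n powr Re s"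
  using norm_nat_powr[of "n - 1" s] by simp

lemma norm_term_le:
  assumes "0 < n" "\<sigma> \<le> Re s"
  shows "norm (u * of_nat n powr - s :: complex) \<le> norm u * real n powr - \<sigma>"
  unfolding norm_mult norm_pos_nat_powr[OF assms(1)] using assms by (intro mult_left_mono powr_mono) auto

text \<open>The one Fubini argument behind products and infinite sums: an absolutely summable family
  of monomials u_i q_i^(-s) over any index set is collected along the fibres of q. Passing to the
  norm of each fibre sum can only decrease the total.\<close>

lemma ds_rep_regroup:
  fixes u :: "'i \<Rightarrow> complex" and q :: "'i \<Rightarrow> nat"
  assumes q: "\<And>i. i \<in> I \<Longrightarrow> 0 < q i"
    and sum: "((\<lambda>i. norm (u i) * real (q i) powr - \<sigma>) has_sum N) I"
    and rep: "\<And>s. \<sigma> \<le> Re s \<Longrightarrow> ((\<lambda>i. u i * of_nat (q i) powr - s) has_sum G s) I"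
  shows "ds_rep \<sigma> N G"
proof -
  define A where "A = (\<lambda>m. {i \<in> I. q i = m})"
  have bij: "bij_betw snd (Sigma {0<..} A) I"
    by (rule bij_betw_byWitness[where f' = "\<lambda>i. (q i, i)"]) (auto simp: A_def q)
  let ?v = "\<lambda>i. norm (u i) * real (q i) powr - \<sigma>"
  have sumA: "?v summable_on A m" for m
    by (rule summable_on_subset_banach[OF has_sum_imp_summable[OF sum]]) (auto simp: A_def)
  have uA: "(\<lambda>i. norm (u i)) summable_on A m" if "m > 0" for m
  proof -
    have "(\<lambda>i. ?v i * real m powr \<sigma>) summable_on A m"
      by (intro summable_on_cmult_left sumA)
    moreover have "?v i * real m powr \<sigma> = norm (u i)" if "i \<in> A m" for i
      using that \<open>m > 0\<close> by (simp add: A_def powr_minus)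
    ultimately show ?thesis using summable_on_cong[of "A m" "\<lambda>i. ?v i * real m powr \<sigma>" "\<lambda>i. norm (u i)"] by simp
  qed
  define b where "b = (\<lambda>m. infsum u (A m))"
  define nb where "nb = (\<lambda>m. infsum ?v (A m))"
  have "((\<lambda>p. ?v (snd p)) has_sum N) (Sigma {0<..} A)"
    using has_sum_reindex_bij_betw[OF bij, of ?v N] sum by simp
  hence nb: "(nb has_sum N) {0<..}"
    by (rule has_sum_Sigma') (simp add: nb_def sumA)
  have le: "norm (b m) * real m powr - \<sigma> \<le> nb m" if m: "m \<in> {0<..}" for m
  proof -
    have "norm (b m) * real m powr - \<sigma> \<le> infsum (\<lambda>i. norm (u i)) (A m) * real m powr - \<sigma>"
      unfolding b_def using m by (intro mult_right_mono norm_infsum_bound uA) auto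
    also have "\<dots> = infsum (\<lambda>i. norm (u i) * real m powr - \<sigma>) (A m)"
      by (rule infsum_cmult_left'[symmetric])
    also have "\<dots> = nb m" unfolding nb_def by (rule infsum_cong) (simp add: A_def)
    finally show ?thesis .
  qed
  have sb: "(\<lambda>n. norm (b n) * real n powr - \<sigma>) summable_on {0<..}"
    by (rule summable_on_comparison_test[OF has_sum_imp_summable[OF nb] le]) auto
  moreover have "(\<Sum>\<^sub>\<infinity>n\<in>{0<..}. norm (b n) * real n powr - \<sigma>) \<le> N"
    using infsum_mono[OF sb has_sum_imp_summable[OF nb] le] infsumI[OF nb] by simp
  moreover have "((\<lambda>n. b n * of_nat n powr - s) has_sum G s) {0<..}" if s: "\<sigma> \<le> Re s" for s
  proof (rule has_sum_Sigma'[where B = A and f = "\<lambda>p. u (snd p) * of_nat (q (snd p)) powr - s"])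
    show "((\<lambda>p. u (snd p) * of_nat (q (snd p)) powr - s) has_sum G s) (Sigma {0<..} A)"
      using has_sum_reindex_bij_betw[OF bij, of "\<lambda>i. u i * of_nat (q i) powr - s"] rep[OF s] by simp
    fix m :: nat assume "m \<in> {0<..}"
    hence "(u has_sum b m) (A m)"
      unfolding b_def by (intro has_sum_infsum abs_summable_summable[OF uA]) simp
    hence "((\<lambda>i. u i * of_nat m powr - s) has_sum b m * of_nat m powr - s) (A m)"
      by (rule has_sum_cmult_left)
    thus "((\<lambda>i. u (snd (m, i)) * of_nat (q (snd (m, i))) powr - s) has_sum b m * of_nat m powr - s) (A m)"
      by (rule has_sum_cong[THEN iffD1, rotated]) (simp add: A_def)
  qed
  ultimately show ?thesis unfolding ds_rep_def by blast
qed

lemma ds_rep_norm_le: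
  assumes "ds_rep \<sigma> N G" "\<sigma> \<le> Re s"
  shows "norm (G s) \<le> N"
proof -
  obtain b where b: "(\<lambda>n. norm (b n) * real n powr - \<sigma>) summable_on {0<..}"
     "(\<Sum>\<^sub>\<infinity>n\<in>{0<..}. norm (b n) * real n powr - \<sigma>) \<le> N"
     "((\<lambda>n. b n * of_nat n powr - s) has_sum G s) {0<..}"
    using assms unfolding ds_rep_def by blast
  have "norm (G s) \<le> (\<Sum>\<^sub>\<infinity>n\<in>{0<..}. norm (b n) * real n powr - \<sigma>)"
    by (rule norm_infsum_le[OF b(3) has_sum_infsum[OF b(1)]]) (auto intro: norm_term_le assms)
  thus ?thesis using b(2) by simp
qed

lemma ds_rep_nonneg: "ds_rep \<sigma> N G \<Longrightarrow> 0 \<le> N"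
  using ds_rep_norm_le[of \<sigma> N G "of_real \<sigma>"] order.trans[OF norm_ge_zero] by simp

lemma ds_rep_monomial:
  assumes "0 < q"
  shows "ds_rep \<sigma> (norm c * real q powr - \<sigma>) (\<lambda>s. c * of_nat q powr - s)"
  by (rule ds_rep_regroup[of "{()}" "\<lambda>_. q" "\<lambda>_. c"]) (use assms in \<open>auto intro!: has_sum_finiteI\<close>)

text \<open>The weights n^(-\<sigma>) are multiplicative, so the weighted double sum factors;
  regrouping pairs by their product gives Dirichlet convolution.\<close>

lemma ds_rep_mult:
  assumes "ds_rep \<sigma> N1 G1" "ds_rep \<sigma> N2 G2"
  shows "ds_rep \<sigma> (N1 * N2) (\<lambda>s. G1 s * G2 s)"
proof -
  let ?w = "\<lambda>b n. norm (b n :: complex) * real n powr - \<sigma>"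
  obtain b1 where b1: "?w b1 summable_on {0<..}" "infsum (?w b1) {0<..} \<le> N1"
     "\<And>s. \<sigma> \<le> Re s \<Longrightarrow> ((\<lambda>n. b1 n * of_nat n powr - s) has_sum G1 s) {0<..}"
    using assms(1) unfolding ds_rep_def by blast
  obtain b2 where b2: "?w b2 summable_on {0<..}" "infsum (?w b2) {0<..} \<le> N2"
     "\<And>s. \<sigma> \<le> Re s \<Longrightarrow> ((\<lambda>n. b2 n * of_nat n powr - s) has_sum G2 s) {0<..}"
    using assms(2) unfolding ds_rep_def by blast
  let ?I = "{0<..} \<times> {0<..} :: (nat \<times> nat) set"
  let ?q = "\<lambda>p::nat \<times> nat. fst p * snd p" and ?u = "\<lambda>p. b1 (fst p) * b2 (snd p)"
  have nn: "(\<lambda>p. norm (?u p) * real (?q p) powr - \<sigma>) = (\<lambda>p. ?w b1 (fst p) * ?w b2 (snd p))"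
    by (auto simp: norm_mult powr_mult mult_ac)
  have inner: "((\<lambda>n. ?w b1 (fst (m, n)) * ?w b2 (snd (m, n))) has_sum ?w b1 m * infsum (?w b2) {0<..}) {0<..}" for m
    by (simp, rule has_sum_cmult_right[OF has_sum_infsum[OF b2(1)]])
  have outer: "((\<lambda>m. ?w b1 m * infsum (?w b2) {0<..}) has_sum infsum (?w b1) {0<..} * infsum (?w b2) {0<..}) {0<..}"
    by (rule has_sum_cmult_left[OF has_sum_infsum[OF b1(1)]])
  have smm: "(\<lambda>p. ?w b1 (fst p) * ?w b2 (snd p)) summable_on ?I"
    by (rule summable_on_SigmaI[OF inner has_sum_imp_summable[OF outer]]) simp
  have sum: "((\<lambda>p. norm (?u p) * real (?q p) powr - \<sigma>) has_sum infsum (?w b1) {0<..} * infsum (?w b2) {0<..}) ?I"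
    unfolding nn by (rule has_sum_SigmaI[OF inner outer smm])
  have "ds_rep \<sigma> (infsum (?w b1) {0<..} * infsum (?w b2) {0<..}) (\<lambda>s. G1 s * G2 s)"
  proof (rule ds_rep_regroup[OF _ sum])
    fix s assume s: "\<sigma> \<le> Re s"
    show "((\<lambda>p. ?u p * of_nat (?q p) powr - s) has_sum G1 s * G2 s) ?I"
    proof (rule has_sum_SigmaI)
      have eq: "?u (m, n) * of_nat (?q (m, n)) powr - s = b1 m * of_nat m powr - s * (b2 n * of_nat n powr - s)" for m n
        using powr_times_real[of "of_nat m" "of_nat n" "- s"] by simp
      show "((\<lambda>n. ?u (m, n) * of_nat (?q (m, n)) powr - s) has_sum b1 m * of_nat m powr - s * G2 s) {0<..}" for m
        unfolding eq by (rule has_sum_cmult_right[OF b2(3)[OF s]])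
      show "((\<lambda>m. b1 m * of_nat m powr - s * G2 s) has_sum G1 s * G2 s) {0<..}"
        by (rule has_sum_cmult_left[OF b1(3)[OF s]])
      show "(\<lambda>p. ?u p * of_nat (?q p) powr - s) summable_on ?I"
        by (rule abs_summable_summable, rule Infinite_Sum.abs_summable_on_comparison_test'[OF has_sum_imp_summable[OF sum]])
           (rule norm_term_le, use s in auto)
    qed
  qed auto
  thus ?thesis
    by (rule ds_rep_mono) (intro mult_mono b1 b2 infsum_nonneg ds_rep_nonneg[OF assms(1)]; simp)
qed

text \<open>Completeness of the algebra: a series whose norms are summable is again represented, by
  regrouping the double family along the second index.\<close>

lemma ds_rep_suminf:
  assumes rep: "\<And>i. ds_rep \<sigma> (N i) (G i)" and N: "summable N"
  shows "ds_rep \<sigma> (suminf N) (\<lambda>s. \<Sum>i. G i s)"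
proof -
  let ?w = "\<lambda>b n. norm (b n :: complex) * real n powr - \<sigma>"
  have "\<forall>i. \<exists>b. ?w b summable_on {0<..} \<and> infsum (?w b) {0<..} \<le> N i \<and>
     (\<forall>s. \<sigma> \<le> Re s \<longrightarrow> ((\<lambda>n. b n * of_nat n powr - s) has_sum G i s) {0<..})"
    using rep by (simp add: ds_rep_def)
  from choice[OF this] obtain b where b: "\<And>i. ?w (b i) summable_on {0<..}" "\<And>i. infsum (?w (b i)) {0<..} \<le> N i"
     "\<And>i s. \<sigma> \<le> Re s \<Longrightarrow> ((\<lambda>n. b i n * of_nat n powr - s) has_sum G i s) {0<..}" by blast
  let ?I = "UNIV \<times> {0<..} :: (nat \<times> nat) set"
  define T where "T = (\<lambda>i. infsum (?w (b i)) {0<..})"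
  have T0: "T i \<ge> 0" for i unfolding T_def by (rule infsum_nonneg) simp
  have Tsum: "summable T" by (rule summable_comparison_test'[OF N, of 0]) (use T0 b(2) in \<open>auto simp: T_def\<close>)
  have Ths: "(T has_sum suminf T) UNIV"
    by (rule norm_summable_imp_has_sum) (use Tsum T0 summable_sums in auto)
  have inner: "((\<lambda>n. ?w (b (fst (i, n))) (snd (i, n))) has_sum T i) {0<..}" for i
    unfolding T_def using has_sum_infsum[OF b(1)[of i]] by simp
  have smm: "(\<lambda>p. ?w (b (fst p)) (snd p)) summable_on ?I"
    by (rule summable_on_SigmaI[OF inner has_sum_imp_summable[OF Ths]]) simp
  have sum: "((\<lambda>p. ?w (b (fst p)) (snd p)) has_sum suminf T) ?I"
    by (rule has_sum_SigmaI[OF inner Ths smm])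
  have "ds_rep \<sigma> (suminf T) (\<lambda>s. \<Sum>i. G i s)"
  proof (rule ds_rep_regroup[OF _ sum])
    fix s assume s: "\<sigma> \<le> Re s"
    show "((\<lambda>p. b (fst p) (snd p) * of_nat (snd p) powr - s) has_sum (\<Sum>i. G i s)) ?I"
    proof (rule has_sum_SigmaI)
      show "((\<lambda>n. b (fst (i, n)) (snd (i, n)) * of_nat (snd (i, n)) powr - s) has_sum G i s) {0<..}" for i
        using b(3)[OF s] by simp
      have "summable (\<lambda>i. norm (G i s))"
        by (rule summable_comparison_test'[OF N, of 0]) (use ds_rep_norm_le[OF rep s] in simp)
      from norm_summable_imp_has_sum[OF this summable_sums[OF summable_norm_cancel[OF this]]]
      show "((\<lambda>i. G i s) has_sum (\<Sum>i. G i s)) UNIV" .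
      show "(\<lambda>p. b (fst p) (snd p) * of_nat (snd p) powr - s) summable_on ?I"
        by (rule abs_summable_summable, rule Infinite_Sum.abs_summable_on_comparison_test'[OF has_sum_imp_summable[OF sum]])
           (rule norm_term_le, use s in auto)
    qed
  qed auto
  thus ?thesis
    by (rule ds_rep_mono) (rule suminf_le[OF _ Tsum N], simp add: T_def b)
qed

lemma ds_rep_const: "ds_rep \<sigma> (norm c) (\<lambda>_. c)"
  using ds_rep_monomial[of 1 \<sigma> c] by simp

lemma ds_rep_power: "ds_rep \<sigma> N G \<Longrightarrow> ds_rep \<sigma> (N ^ k) (\<lambda>s. G s ^ k)"
  using ds_rep_const[of \<sigma> 1] by (induction k) (auto intro: ds_rep_mult)

lemma ds_rep_exp:
  assumes "ds_rep \<sigma> N G"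
  shows "ds_rep \<sigma> (exp N) (\<lambda>s. exp (G s))"
proof -
  have e: "(\<Sum>k. inverse (fact k) * x ^ k) = exp x" "summable (\<lambda>k. inverse (fact k) * x ^ k)"
    for x :: "'a :: {real_normed_field, banach}"
    using exp_converges[of x] by (simp_all add: sums_iff scaleR_conv_of_real)
  have "ds_rep \<sigma> (\<Sum>k. norm (inverse (fact k) :: complex) * N ^ k) (\<lambda>s. \<Sum>k. inverse (fact k) * G s ^ k)"
  proof (rule ds_rep_suminf)
    show "ds_rep \<sigma> (norm (inverse (fact k) :: complex) * N ^ k) (\<lambda>s. inverse (fact k) * G s ^ k)" for k
      by (intro ds_rep_mult ds_rep_const ds_rep_power assms)
    show "summable (\<lambda>k. norm (inverse (fact k) :: complex) * N ^ k)"
      using e(2)[of N] by (simp add: norm_inverse)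
  qed
  moreover have "norm (inverse (fact k) :: complex) = inverse (fact k)" for k
    by (simp add: norm_inverse)
  ultimately show ?thesis by (simp only: e)
qed

lemma ds_rep_ds_sum:
  assumes "summable (\<lambda>n. norm (b (Suc n)) * real (Suc n) powr - \<sigma>)"
  shows "ds_rep \<sigma> (\<Sum>n. norm (b (Suc n)) * real (Suc n) powr - \<sigma>) (ds_sum b)"
proof (rule ds_rep_regroup[of UNIV Suc "\<lambda>n. b (Suc n)"])
  show "((\<lambda>n. norm (b (Suc n)) * real (Suc n) powr - \<sigma>) has_sum (\<Sum>n. norm (b (Suc n)) * real (Suc n) powr - \<sigma>)) UNIV"
    by (rule norm_summable_imp_has_sum) (use assms summable_sums in auto)
  fix s assume s: "\<sigma> \<le> Re s"
  have "summable (\<lambda>n. norm (ds_term b s n))"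
  proof (rule summable_comparison_test'[OF assms, of 0])
    show "norm (norm (ds_term b s n)) \<le> norm (b (Suc n)) * real (Suc n) powr - \<sigma>" for n
      using norm_term_le[of "Suc n" \<sigma> s "b (Suc n)"] s by (simp add: ds_term_def)
  qed
  from norm_summable_imp_has_sum[OF this summable_sums[OF summable_norm_cancel[OF this]]]
  show "((\<lambda>n. b (Suc n) * of_nat (Suc n) powr - s) has_sum ds_sum b s) UNIV"
    by (simp add: ds_term_def[abs_def] ds_sum_def)
qed auto

lemma ds_rep_imp_sums:
  assumes "ds_rep \<sigma> N G"
  obtains b where "summable (\<lambda>n. norm (b (Suc n)) * real (Suc n) powr - \<sigma>)"
    "\<And>s. \<sigma> \<le> Re s \<Longrightarrow> ds_term b s sums G s"
proof -
  obtain b where b: "(\<lambda>n. norm (b n) * real n powr - \<sigma>) summable_on {0<..}"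
     "\<And>s. \<sigma> \<le> Re s \<Longrightarrow> ((\<lambda>n. b n * of_nat n powr - s) has_sum G s) {0<..}"
    using assms unfolding ds_rep_def by blast
  have bij: "bij_betw Suc UNIV {0<..}"
    by (rule bij_betw_byWitness[where f' = "\<lambda>n. n - 1"]) auto
  have "summable (\<lambda>n. norm (b (Suc n)) * real (Suc n) powr - \<sigma>)"
    using summable_on_reindex_bij_betw[OF bij, of "\<lambda>n. norm (b n) * real n powr - \<sigma>"] b(1)
    by (intro summable_on_imp_summable) simp
  moreover have "ds_term b s sums G s" if "\<sigma> \<le> Re s" for s
    using has_sum_reindex_bij_betw[OF bij, of "\<lambda>n. b n * of_nat n powr - s"] b(2)[OF that]
    unfolding ds_term_def[abs_def] by (intro has_sum_imp_sums) simp
  ultimately show ?thesis using that by blast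
qed

section \<open>Substituting a symbol into a Dirichlet series\<close>

lemma of_nat_powr_conv_exp: "0 < m \<Longrightarrow> of_nat m powr w = exp (w * of_real (ln (real m)) :: complex)"
  using Ln_of_real[of "real m"] by (simp add: powr_def)

text \<open>Each term n^(-(c0 s + c + g)) factors as n^(-c) (n^c0)^(-s) exp(-g log n). The middle
  factor is a monomial because c0 is a natural number, and the exponential has norm at most exp(N
  log n) = n^N. This loss of n^N explains the exponent in the hypothesis.\<close>

lemma ds_rep_compose:
  fixes c :: complex
  assumes g: "ds_rep \<sigma> N g"
    and a: "summable (\<lambda>n. norm (a (Suc n)) * real (Suc n) powr - (real c0 * \<sigma> + Re c - N))"
  obtains N' where "ds_rep \<sigma> N' (\<lambda>s. ds_sum a (of_nat c0 * s + c + g s))"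
proof -
  define L where "L = (\<lambda>n. ln (real (Suc n)))"
  have L0: "L n \<ge> 0" for n by (simp add: L_def)
  have pow: "of_nat (Suc n) powr w = exp (w * of_real (L n))" for n and w :: complex
    unfolding L_def by (rule of_nat_powr_conv_exp) simp
  have powq: "of_nat (Suc n ^ c0) powr - s = exp (- (of_nat c0 * s) * of_real (L n))" for n and s :: complex
    unfolding L_def by (subst of_nat_powr_conv_exp) (simp, simp only: of_nat_power ln_realpow of_real_mult of_real_of_nat_eq mult_minus_left mult_ac)
  have rpow: "real (Suc n) powr x = exp (x * L n)" for n x
    by (simp add: powr_def L_def)
  have rpowq: "real (Suc n ^ c0) powr x = exp (real c0 * x * L n)" for n x
    by (simp add: powr_def L_def ln_realpow)
  define T where "T = (\<lambda>n s. (a (Suc n) * of_nat (Suc n) powr - c) * of_nat (Suc n ^ c0) powr - s * exp (- of_real (L n) * g s))"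
  have T: "ds_term a (of_nat c0 * s + c + g s) n = T n s" for n s
    unfolding ds_term_def T_def pow powq by (simp add: mult.assoc algebra_simps flip: exp_add)
  have norms: "norm (a (Suc n) * of_nat (Suc n) powr - c) * real (Suc n ^ c0) powr - \<sigma> * exp (norm (- of_real (L n) :: complex) * N)
      = norm (a (Suc n)) * real (Suc n) powr - (real c0 * \<sigma> + Re c - N)" for n
    unfolding norm_mult norm_nat_powr rpow rpowq using L0[of n]
    by (simp add: algebra_simps flip: exp_add)
  have "ds_rep \<sigma> (norm (a (Suc n)) * real (Suc n) powr - (real c0 * \<sigma> + Re c - N)) (T n)" for n
    unfolding T_def norms[symmetric] by (intro ds_rep_mult ds_rep_monomial ds_rep_exp ds_rep_const g) simp
  hence "ds_rep \<sigma> (\<Sum>n. norm (a (Suc n)) * real (Suc n) powr - (real c0 * \<sigma> + Re c - N)) (\<lambda>s. \<Sum>n. T n s)"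
    using a by (intro ds_rep_suminf)
  thus ?thesis using that by (simp add: ds_sum_def T[abs_def])
qed

text \<open>Without the constant term all frequencies are at least 2, so raising the abscissa from
  \<sigma>1 to \<sigma> shrinks the norm by at least 2^(\<sigma>1-\<sigma>).\<close>

lemma ds_rep_tail:
  assumes "\<forall>s\<in>half_plane \<sigma>0. ds_converges f s"
  obtains K \<sigma>1 where "\<sigma>0 < \<sigma>1" "\<And>\<sigma>. \<sigma>1 \<le> \<sigma> \<Longrightarrow> ds_rep \<sigma> (K * 2 powr - \<sigma>) (\<lambda>s. ds_sum f s - f 1)"
proof -
  define s0 :: complex where "s0 = of_real (\<sigma>0 + 1)"
  \<comment> \<open>Convergence at \<sigma>0 + 1 makes the terms bounded there; two further units
    supply the summable factor n^(-2).\<close>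
  define \<sigma>1 where "\<sigma>1 = \<sigma>0 + 3"
  have "summable (ds_term f s0)" using assms by (auto simp: s0_def ds_converges_def)
  then obtain B where B: "\<And>n. norm (ds_term f s0 n) \<le> B"
    using summable_imp_Bseq[of "ds_term f s0"] unfolding Bseq_def by blast
  define h where "h = (\<lambda>n. if n = 1 then 0 else f n)"
  have coeff: "norm (f (Suc n)) * real (Suc n) powr - \<sigma>1 \<le> B * real (Suc n) powr - 2" for n
  proof -
    have "norm (f (Suc n)) * real (Suc n) powr - \<sigma>1 = norm (ds_term f s0 n) * real (Suc n) powr - 2"
      proof -
      have "- Re s0 + - 2 = - \<sigma>1" by (simp add: s0_def \<sigma>1_def)
      thus ?thesis unfolding norm_ds_term mult.assoc powr_add[symmetric] by simp
    qed
    thus ?thesis using B by (simp add: mult_right_mono)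
  qed
  have "summable (\<lambda>n. real (Suc n) powr - 2)"
    using summable_real_powr_iff[of "-2"] by (subst summable_Suc_iff) simp
  hence "summable (\<lambda>n. B * real (Suc n) powr - 2)" by (rule summable_mult)
  hence sf: "summable (\<lambda>n. norm (f (Suc n)) * real (Suc n) powr - \<sigma>1)"
    by (rule summable_comparison_test'[where N = 0]) (use coeff in \<open>simp del: of_nat_Suc\<close>)
  have sh: "summable (\<lambda>n. norm (h (Suc n)) * real (Suc n) powr - \<sigma>1)"
    by (rule summable_comparison_test'[OF sf, where N = 0]) (simp add: h_def)
  define K where "K = 2 powr \<sigma>1 * (\<Sum>n. norm (h (Suc n)) * real (Suc n) powr - \<sigma>1)"
  have "ds_rep \<sigma> (K * 2 powr - \<sigma>) (\<lambda>s. ds_sum f s - f 1)" if \<sigma>: "\<sigma>1 \<le> \<sigma>" for \<sigma>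
  proof -
    have le: "norm (h (Suc n)) * real (Suc n) powr - \<sigma> \<le> 2 powr (\<sigma>1 - \<sigma>) * (norm (h (Suc n)) * real (Suc n) powr - \<sigma>1)" for n
    proof (cases "n = 0")
      case False
      have "real (Suc n) powr - \<sigma> = real (Suc n) powr (\<sigma>1 - \<sigma>) * real (Suc n) powr - \<sigma>1"
        by (subst powr_add[symmetric]) simp
      also have "\<dots> \<le> 2 powr (\<sigma>1 - \<sigma>) * real (Suc n) powr - \<sigma>1"
        using \<sigma> False by (intro mult_right_mono powr_mono2') auto
      finally show ?thesis
        by (subst mult.left_commute) (rule mult_left_mono, auto)
    qed (simp add: h_def)
    have sh2: "summable (\<lambda>n. 2 powr (\<sigma>1 - \<sigma>) * (norm (h (Suc n)) * real (Suc n) powr - \<sigma>1))"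
      by (intro summable_mult sh)
    have sh': "summable (\<lambda>n. norm (h (Suc n)) * real (Suc n) powr - \<sigma>)"
      by (rule summable_comparison_test'[OF sh2, of 0]) (use le in auto)
    have "(\<Sum>n. norm (h (Suc n)) * real (Suc n) powr - \<sigma>) \<le> 2 powr (\<sigma>1 - \<sigma>) * (\<Sum>n. norm (h (Suc n)) * real (Suc n) powr - \<sigma>1)"
      using suminf_le[OF le sh' sh2] suminf_mult[OF sh] by simp
    also have "\<dots> = K * 2 powr - \<sigma>" by (simp add: K_def powr_diff powr_minus field_simps)
    finally have "ds_rep \<sigma> (K * 2 powr - \<sigma>) (ds_sum h)"
      by (rule ds_rep_mono[OF ds_rep_ds_sum[OF sh']])
    thus ?thesis
    proof (rule ds_rep_cong)
      fix s assume "\<sigma> \<le> Re s"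
      hence sm: "summable (ds_term f s)" using assms \<sigma> by (auto simp: ds_converges_def \<sigma>1_def)
      have "ds_term h s (Suc n) = ds_term f s (Suc n)" for n by (simp add: ds_term_def h_def)
      moreover from this have "summable (ds_term h s)"
        using sm summable_Suc_iff[of "ds_term h s"] summable_Suc_iff[of "ds_term f s"] by simp
      ultimately show "ds_sum h s = ds_sum f s - f 1"
        unfolding ds_sum_def using suminf_split_head[OF sm] suminf_split_head[of "ds_term h s"]
        by (simp add: ds_term_def h_def)
    qed
  qed
  thus ?thesis using that[of \<sigma>1 K] by (simp add: \<sigma>1_def)
qed

section \<open>Unboundedness near the critical line\<close>

text \<open>A gliding hump in place of the uniform boundedness principle: \<open>\<theta>\<close> aligns the phases of one
  functional \<open>\<Lambda> j\<close> on each of a sequence of consecutive blocks that carry most of its mass.\<close>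

lemma gliding_hump:
  fixes \<Lambda> :: "'j \<Rightarrow> nat \<Rightarrow> complex"
  assumes summ: "\<And>j. j \<in> J \<Longrightarrow> summable (\<lambda>n. norm (\<Lambda> j n))"
    and dom: "\<And>j n. j \<in> J \<Longrightarrow> norm (\<Lambda> j n) \<le> m n"
    and large: "\<And>B. \<exists>j\<in>J. B < (\<Sum>n. norm (\<Lambda> j n))"
  obtains \<theta> where "\<And>n. norm (\<theta> n) \<le> 1" "\<And>B. \<exists>j\<in>J. B < norm (\<Sum>n. \<theta> n * \<Lambda> j n)"
proof -
  \<comment> \<open>Head and tail are each paid for twice: once as mass missing from the block and
    once as possibly opposed phases. The head is at most the sum of m, whichever j is chosen, and
    the tail is below 1, so the required margin is 2 * head + k + 2.\<close>
  have "\<exists>j N'. j \<in> J \<and> N < N' \<and> 2 * (\<Sum>n<N. m n) + real k + 2 < (\<Sum>n. norm (\<Lambda> j n)) \<and>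
      (\<Sum>n. norm (\<Lambda> j (n + N'))) < 1" for k N
  proof -
    obtain j where j: "j \<in> J" "2 * (\<Sum>n<N. m n) + real k + 2 < (\<Sum>n. norm (\<Lambda> j n))"
      using large by blast
    obtain N0 where N0: "\<And>N'. N' \<ge> N0 \<Longrightarrow> norm (\<Sum>n. norm (\<Lambda> j (n + N'))) < 1"
      using suminf_exist_split[OF _ summ[OF j(1)], of 1] by auto
    show ?thesis using j N0[of "max N0 (Suc N)"] by (intro exI[of _ j] exI[of _ "max N0 (Suc N)"]) auto
  qed
  then obtain pick nxt where pn: "\<And>k N. pick k N \<in> J" "\<And>k N. N < nxt k N"
      "\<And>k N. 2 * (\<Sum>n<N. m n) + real k + 2 < (\<Sum>n. norm (\<Lambda> (pick k N) n))"
      "\<And>k N. (\<Sum>n. norm (\<Lambda> (pick k N) (n + nxt k N))) < 1"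
    by metis
  define Ns where "Ns = rec_nat 0 nxt"
  have Ns: "Ns (Suc k) = nxt k (Ns k)" for k by (simp add: Ns_def)
  have mono: "strict_mono Ns" by (rule strict_monoI_Suc) (simp add: Ns pn)
  define blk where "blk = (\<lambda>n. LEAST k. n < Ns (Suc k))"
  have blk: "blk n = k" if "Ns k \<le> n" "n < Ns (Suc k)" for n k
    unfolding blk_def
  proof (rule Least_equality)
    show "k \<le> y" if "n < Ns (Suc y)" for y
    proof (rule ccontr)
      assume "\<not> k \<le> y"
      hence "Ns (Suc y) \<le> Ns k" using strict_mono_less_eq[OF mono] by simp
      thus False using that \<open>Ns k \<le> n\<close> by simp
    qed
  qed fact
  define js where "js = (\<lambda>k. pick k (Ns k))"
  \<comment> \<open>Since \<open>sgn 0 = 0\<close>, some \<theta> n may vanish; hence norm at most 1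
    rather than equal to 1.\<close>
  define \<theta> where "\<theta> = (\<lambda>n. cnj (sgn (\<Lambda> (js (blk n)) n)))"
  have \<theta>1: "norm (\<theta> n) \<le> 1" for n by (simp add: \<theta>_def norm_sgn)
  have "real k < norm (\<Sum>n. \<theta> n * \<Lambda> (js k) n)" for k
  proof -
    define N N' where "N = Ns k" and "N' = Ns (Suc k)"
    have NN: "N \<le> N'" unfolding N_def N'_def using strict_mono_less_eq[OF mono] by simp
    define x where "x = (\<lambda>n. norm (\<Lambda> (js k) n))"
    define r where "r = (\<lambda>n. Re (\<theta> n * \<Lambda> (js k) n))"
    have js: "js k \<in> J" by (simp add: js_def pn)
    have sx: "summable x" unfolding x_def by (rule summ[OF js])
    have le: "norm (\<theta> n * \<Lambda> (js k) n) \<le> x n" for n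
      unfolding norm_mult x_def using mult_right_mono[OF \<theta>1 norm_ge_zero] by simp
    have st: "summable (\<lambda>n. \<theta> n * \<Lambda> (js k) n)"
      by (rule summable_comparison_test'[OF sx, of 0]) (use le in auto)
    have sr: "summable r" unfolding r_def by (rule summable_Re[OF st])
    have abs_r: "\<bar>r n\<bar> \<le> x n" for n unfolding r_def using abs_Re_le_cmod le order.trans by blast
    have aligned: "r n = x n" if "n \<in> {N..<N'}" for n
    proof -
      have "blk n = k" using that by (intro blk) (auto simp: N_def N'_def)
      hence "\<theta> n * \<Lambda> (js k) n = of_real (x n)"
        by (simp add: \<theta>_def x_def sgn_div_norm scaleR_conv_of_real complex_norm_square[symmetric]
            power2_eq_square mult.commute[of _ "cnj _"] field_simps)
      thus ?thesis unfolding r_def by (simp only: Re_complex_of_real)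
    qed
    have split: "suminf h = (\<Sum>n<N. h n) + (\<Sum>n\<in>{N..<N'}. h n) + (\<Sum>n. h (n + N'))" if "summable h" for h :: "nat \<Rightarrow> real"
      using suminf_split_initial_segment[OF that, of N'] sum.atLeastLessThan_concat[of 0 N N' h] NN
      by (simp add: atLeast0LessThan)
    have "(\<Sum>n<N. x n) \<le> (\<Sum>n<N. m n)" unfolding x_def by (intro sum_mono dom js)
    moreover have "(\<Sum>n. x (n + N')) < 1" using pn(4)[of k "Ns k"] by (simp add: x_def N'_def Ns js_def)
    moreover have "2 * (\<Sum>n<N. m n) + real k + 2 < suminf x" using pn(3)[where k = k and N = "Ns k"] by (simp add: x_def N_def js_def)
    moreover have "- (\<Sum>n<N. x n) \<le> (\<Sum>n<N. r n)"
      unfolding sum_negf[symmetric] by (intro sum_mono) (use abs_r in \<open>simp add: abs_le_iff minus_le_iff\<close>)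
    moreover have "- (\<Sum>n. x (n + N')) \<le> (\<Sum>n. r (n + N'))"
    proof -
      have "(\<Sum>n. - x (n + N')) \<le> (\<Sum>n. r (n + N'))"
        by (intro suminf_le summable_minus summable_ignore_initial_segment sx sr)
           (use abs_r in \<open>simp add: abs_le_iff minus_le_iff\<close>)
      thus ?thesis using suminf_minus[OF summable_ignore_initial_segment[OF sx]] by simp
    qed
    moreover have "(\<Sum>n\<in>{N..<N'}. r n) = (\<Sum>n\<in>{N..<N'}. x n)" by (intro sum.cong refl aligned)
    ultimately have "real k < suminf r" using split[OF sx] split[OF sr] by linarith
    also have "suminf r = Re (\<Sum>n. \<theta> n * \<Lambda> (js k) n)" unfolding r_def by (rule Re_suminf[OF st, symmetric])
    also have "\<dots> \<le> norm (\<Sum>n. \<theta> n * \<Lambda> (js k) n)" by (rule complex_Re_le_cmod)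
    finally show ?thesis .
  qed
  moreover have "js k \<in> J" for k by (simp add: js_def pn)
  ultimately have "\<exists>j\<in>J. B < norm (\<Sum>n. \<theta> n * \<Lambda> j n)" for B
    using reals_Archimedean2[of B] by (meson less_trans)
  thus ?thesis using that \<theta>1 by blast
qed

text \<open>The functionals are evaluations at w on series with coefficients \<theta>(n) n^(-1/2).
  Their total masses \<zeta>(1/2 + Re w) are unbounded near the line, while each entry is dominated
  by 1/n, as the hump construction requires.\<close>

lemma H_plus_unbounded_near_boundary:
  assumes W: "\<And>w. w \<in> W \<Longrightarrow> 1/2 < Re w" and near: "\<And>\<epsilon>. 0 < \<epsilon> \<Longrightarrow> \<exists>w\<in>W. Re w \<le> 1/2 + \<epsilon>"
  obtains a where "a \<in> H_plus" "\<not> bounded (ds_sum a ` W)"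
proof -
  define \<Lambda> where "\<Lambda> = (\<lambda>w n. of_nat (Suc n) powr (- (1/2) - w) :: complex)"
  have norm\<Lambda>: "norm (\<Lambda> w n) = real (Suc n) powr (- (1/2) - Re w)" for w n
    unfolding \<Lambda>_def norm_nat_powr by simp
  have summ: "summable (\<lambda>n. norm (\<Lambda> w n))" if "w \<in> W" for w
    unfolding norm\<Lambda> using summable_real_powr_iff[of "- (1/2) - Re w"] W[OF that]
    by (subst summable_Suc_iff) simp
  have dom: "norm (\<Lambda> w n) \<le> real (Suc n) powr (- 1)" if "w \<in> W" for w n
    unfolding norm\<Lambda> using W[OF that] by (intro powr_mono) auto
  have large: "\<exists>w\<in>W. B < (\<Sum>n. norm (\<Lambda> w n))" for B
  proof -
    have "\<exists>N. 2 * B < (\<Sum>n<N. real (Suc n) powr (- 1))"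
    proof (rule ccontr)
      assume "\<not> ?thesis"
      hence "summable (\<lambda>n. real (Suc n) powr (- 1))"
        by (intro summableI_nonneg_bounded[of _ "2 * B"]) (auto simp: not_less)
      thus False using summable_real_powr_iff[of "-1"] by (subst (asm) summable_Suc_iff) simp
    qed
    then obtain N where N: "2 * B < (\<Sum>n<N. real (Suc n) powr (- 1))" by blast
    \<comment> \<open>\<epsilon> is chosen so that x^(-\<epsilon>) = 1/2: each of the first N
      harmonic terms then keeps at least half its size. The shift by 2 keeps ln x positive even for
      N = 0.\<close>
    define x where "x = real (N + 2)"
    define \<epsilon> where "\<epsilon> = ln 2 / ln x"
    have x: "x \<ge> 2" by (simp add: x_def)
    hence lx: "ln x > 0" by simp
    have \<epsilon>: "\<epsilon> > 0" using lx by (simp add: \<epsilon>_def)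
    then obtain w where w: "w \<in> W" "Re w \<le> 1/2 + \<epsilon>" using near by blast
    have x\<epsilon>: "x powr - \<epsilon> = 1/2" using x lx by (simp add: powr_def \<epsilon>_def exp_minus)
    have "(\<Sum>n<N. real (Suc n) powr (- 1)) * (1/2) \<le> (\<Sum>n<N. norm (\<Lambda> w n))"
      unfolding sum_distrib_right
    proof (rule sum_mono)
      fix n assume n: "n \<in> {..<N}"
      have "real (Suc n) powr (- 1) * (1/2) \<le> real (Suc n) powr (- 1) * real (Suc n) powr - \<epsilon>"
        unfolding x\<epsilon>[symmetric] using n \<epsilon> by (intro mult_left_mono powr_mono2') (auto simp: x_def)
      also have "\<dots> = real (Suc n) powr (- 1 - \<epsilon>)" by (subst powr_add[symmetric]) simp
      also have "\<dots> \<le> norm (\<Lambda> w n)" unfolding norm\<Lambda> using w by (intro powr_mono) auto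
      finally show "real (Suc n) powr (- 1) * (1/2) \<le> norm (\<Lambda> w n)" .
    qed
    also have "\<dots> \<le> (\<Sum>n. norm (\<Lambda> w n))" by (intro sum_le_suminf summ w) auto
    finally show ?thesis using N w by (intro bexI[of _ w]) auto
  qed
  obtain \<theta> where \<theta>: "\<And>n. norm (\<theta> n) \<le> 1" "\<And>B. \<exists>w\<in>W. B < norm (\<Sum>n. \<theta> n * \<Lambda> w n)"
    by (rule gliding_hump[of W \<Lambda> "\<lambda>n. real (Suc n) powr (- 1)", OF summ dom large]) blast+
  \<comment> \<open>\<theta> is indexed from 0 and the coefficients from 1, whence
    \<open>n - 1\<close>.\<close>
  define a :: dirichlet_series where "a = (\<lambda>n. \<theta> (n - 1) * of_nat n powr (- (1/2)))"
  have "ds_term a w n = \<theta> n * \<Lambda> w n" for w n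
    unfolding ds_term_def a_def \<Lambda>_def diff_conv_add_uminus powr_add by (simp add: mult.assoc)
  hence ds: "ds_sum a w = (\<Sum>n. \<theta> n * \<Lambda> w n)" for w by (simp add: ds_sum_def)
  have "a \<in> H_plus" unfolding H_plus_def
  proof (intro CollectI allI impI)
    fix \<sigma> :: real assume "\<sigma> > 0"
    hence "summable (\<lambda>n. real (Suc n) powr (- 1 - 2 * \<sigma>))"
      using summable_real_powr_iff[of "- 1 - 2 * \<sigma>"] by (subst summable_Suc_iff) simp
    thus "summable (\<lambda>n. (cmod (a (Suc n)))\<^sup>2 * real (Suc n) powr (- 2 * \<sigma>))"
    proof (rule summable_comparison_test'[where N = 0])
      fix n
      have "norm (a (Suc n)) \<le> 1 * real (Suc n) powr (- (1/2))"
        unfolding a_def norm_mult norm_nat_powr using \<theta>(1) by (intro mult_mono) auto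
      hence "(norm (a (Suc n)))\<^sup>2 \<le> (real (Suc n) powr (- (1/2)))\<^sup>2" by (intro power_mono) auto
      also have "\<dots> = real (Suc n) powr (- 1)"
        unfolding power2_eq_square powr_add[symmetric] by simp
      finally have "(norm (a (Suc n)))\<^sup>2 * real (Suc n) powr (- 2 * \<sigma>) \<le> real (Suc n) powr (- 1) * real (Suc n) powr (- 2 * \<sigma>)"
        by (rule mult_right_mono) simp
      also have "\<dots> = real (Suc n) powr (- 1 - 2 * \<sigma>)" by (subst powr_add[symmetric]) simp
      finally show "norm ((cmod (a (Suc n)))\<^sup>2 * real (Suc n) powr (- 2 * \<sigma>)) \<le> real (Suc n) powr (- 1 - 2 * \<sigma>)"
        by simp
    qed
  qed
  moreover have "\<not> bounded (ds_sum a ` W)"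
    unfolding bounded_iff using \<theta>(2) by (auto simp: ds not_le)
  ultimately show ?thesis by (rule that)
qed

section \<open>Composition operators\<close>

lemma H_plus_abs_summable:
  assumes a: "a \<in> H_plus" and p: "1/2 < p"
  shows "summable (\<lambda>n. norm (a (Suc n)) * real (Suc n) powr - p)"
proof -
  \<comment> \<open>Splitting n^(-p) as n^(-\<sigma>) n^(-(p-\<sigma>)) leaves the exponent 2(p -
    \<sigma>) = p + 1/2 > 1, so both squared factors are summable.\<close>
  define \<sigma> where "\<sigma> = (p - 1/2) / 2"
  have "\<sigma> > 0" using p by (simp add: \<sigma>_def)
  hence s1: "summable (\<lambda>n. (cmod (a (Suc n)))\<^sup>2 * real (Suc n) powr (- 2 * \<sigma>))"
    using a by (simp add: H_plus_def)
  have s2: "summable (\<lambda>n. real (Suc n) powr (- 2 * (p - \<sigma>)))"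
    using summable_real_powr_iff[of "- 2 * (p - \<sigma>)"] p by (subst summable_Suc_iff) (simp add: \<sigma>_def field_simps)
  have le: "norm (a (Suc n)) * real (Suc n) powr - p \<le>
      (cmod (a (Suc n)))\<^sup>2 * real (Suc n) powr (- 2 * \<sigma>) + real (Suc n) powr (- 2 * (p - \<sigma>))" for n
  proof -
    define u v where "u = cmod (a (Suc n)) * real (Suc n) powr - \<sigma>" and "v = real (Suc n) powr - (p - \<sigma>)"
    have sq: "(real (Suc n) powr x)\<^sup>2 = real (Suc n) powr (2 * x)" for x
      by (simp add: power2_eq_square flip: powr_add)
    have "norm (a (Suc n)) * real (Suc n) powr - p = u * v"
      unfolding u_def v_def mult.assoc powr_add[symmetric] by simp
    also have "\<dots> \<le> u\<^sup>2 + v\<^sup>2"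
    proof -
      have "u * v \<ge> 0" by (simp add: u_def v_def)
      thus ?thesis using sum_squares_bound[of u v] by linarith
    qed
    finally show ?thesis unfolding u_def v_def power_mult_distrib sq by simp
  qed
  show ?thesis
    by (rule summable_comparison_test'[OF summable_add[OF s1 s2], where N = 0]) (use le in \<open>simp del: of_nat_Suc\<close>)
qed

lemma abs_summable_ds:
  assumes "summable (\<lambda>n. norm (a (Suc n)) * real (Suc n) powr - p)"
  shows "p \<le> Re s \<Longrightarrow> ds_term a s sums ds_sum a s"
    and "p \<le> Re s \<Longrightarrow> norm (ds_sum a s) \<le> (\<Sum>n. norm (a (Suc n)) * real (Suc n) powr - p)"
    and "ds_sum a holomorphic_on half_plane p"
proof -
  have le: "norm (ds_term a s n) \<le> norm (a (Suc n)) * real (Suc n) powr - p" if "p \<le> Re s" for s n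
    unfolding ds_term_def using norm_term_le[of "Suc n" p s "a (Suc n)"] that by simp
  have sums: "ds_term a s sums ds_sum a s" if "p \<le> Re s" for s
  proof -
    have "summable (ds_term a s)"
      by (rule summable_comparison_test'[OF assms, where N = 0]) (rule le[OF that])
    thus ?thesis unfolding ds_sum_def by (rule summable_sums)
  qed
  show "p \<le> Re s \<Longrightarrow> ds_term a s sums ds_sum a s" by (rule sums)
  show "p \<le> Re s \<Longrightarrow> norm (ds_sum a s) \<le> (\<Sum>n. norm (a (Suc n)) * real (Suc n) powr - p)"
    by (rule norm_sums_le[OF sums summable_sums[OF assms] le])
  define h where "h = (\<lambda>n. of_real (norm (a (Suc n)) * real (Suc n) powr - p) :: complex)"
  have diff: "(\<lambda>s. ds_term a s n) field_differentiable (at x)" for n x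
  proof -
    have "(\<lambda>s. ds_term a s n) holomorphic_on UNIV" unfolding ds_term_def by (intro holomorphic_intros)
    thus ?thesis by (simp add: holomorphic_on_def)
  qed
  have dom: "\<exists>d h. 0 < d \<and> summable h \<and> range h \<subseteq> \<real>\<^sub>\<ge>\<^sub>0 \<and>
      (\<forall>\<^sub>F n in sequentially. \<forall>y\<in>ball x d \<inter> half_plane p. cmod (ds_term a y n) \<le> cmod (h n :: complex))" for x
  proof (intro exI conjI)
    show "summable h" unfolding h_def summable_complex_of_real by (rule assms)
    show "range h \<subseteq> \<real>\<^sub>\<ge>\<^sub>0" by (auto simp: h_def)
    show "\<forall>\<^sub>F n in sequentially. \<forall>y\<in>ball x 1 \<inter> half_plane p. cmod (ds_term a y n) \<le> cmod (h n)"
      unfolding h_def norm_of_real using le by (intro always_eventually) (fastforce simp del: of_nat_Suc)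
  qed simp
  obtain g where g: "\<And>s. s \<in> half_plane p \<Longrightarrow> (\<lambda>n. ds_term a s n) sums g s"
    and gd: "\<And>s. s \<in> half_plane p \<Longrightarrow> g field_differentiable (at s)"
    by (rule series_differentiable_comparison_complex[of "half_plane p" "\<lambda>n s. ds_term a s n", OF half_plane_simps(2) diff dom]) blast+
  have "g holomorphic_on half_plane p"
    using gd by (auto simp: holomorphic_on_def field_differentiable_at_within)
  moreover have "ds_sum a s = g s" if "s \<in> half_plane p" for s
    using g[OF that] by (simp add: ds_sum_def sums_iff)
  ultimately show "ds_sum a holomorphic_on half_plane p"
    by (metis (no_types, lifting) holomorphic_transform)
qed

lemma H_plus_holomorphic:
  assumes "a \<in> H_plus"
  shows "ds_sum a holomorphic_on half_plane (1/2)"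
proof -
  have "ds_sum a field_differentiable (at s)" if "1/2 < Re s" for s
  proof -
    define p where "p = (1/2 + Re s) / 2"
    have "1/2 < p" "p < Re s" using that by (auto simp: p_def)
    thus ?thesis
      using abs_summable_ds(3)[OF H_plus_abs_summable[OF assms]] holomorphic_on_imp_differentiable_at[of _ "half_plane p"]
      by simp
  qed
  thus ?thesis by (auto simp: holomorphic_on_def field_differentiable_at_within)
qed

section \<open>Behaviour of the symbol \<phi>\<close>

context
  fixes \<phi> :: "complex \<Rightarrow> complex" and c0 :: nat and f :: dirichlet_series
  assumes hol: "\<phi> holomorphic_on half_plane 0"
    and into: "\<phi> ` half_plane 0 \<subseteq> half_plane (1/2)"
    and rep: "\<exists>\<sigma>\<ge>0. \<forall>s\<in>half_plane \<sigma>. ds_converges f s \<and> \<phi> s = of_nat c0 * s + ds_sum f s"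
begin

lemma Re_symbol: "0 < Re s \<Longrightarrow> 1/2 < Re (\<phi> s)"
  using into by (auto simp: image_subset_iff)

lemma harnack_symbol:
  assumes "0 < Re z" "0 < Re w" "Im z = Im w"
  shows "min (Re z / Re w) (Re w / Re z) * (Re (\<phi> w) - 1/2) \<le> Re (\<phi> z) - 1/2"
proof -
  have "(\<lambda>s. \<phi> s - 1/2) holomorphic_on half_plane 0" by (intro holomorphic_intros hol)
  moreover have "(\<lambda>s. \<phi> s - 1/2) ` half_plane 0 \<subseteq> half_plane 0" using Re_symbol by auto
  ultimately show ?thesis using harnack_horizontal[of "\<lambda>s. \<phi> s - 1/2" z w] assms by simp
qed

text \<open>For \<open>c0 = 0\<close> the constant term satisfies \<open>Re (f 1) > 1/2\<close> strictly: otherwise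
  \<open>Re \<phi> - 1/2\<close> would decay like \<open>2 powr - \<sigma>\<close>, faster than the rate \<open>1 / \<sigma>\<close> allowed by Harnack.\<close>

lemma symbol_expansion:
  obtains g K \<sigma>1 \<delta> where "0 < \<sigma>1" "0 < \<delta>"
    "\<And>\<sigma>. \<sigma>1 \<le> \<sigma> \<Longrightarrow> ds_rep \<sigma> (K * 2 powr - \<sigma>) g"
    "\<And>s. \<sigma>1 \<le> Re s \<Longrightarrow> \<phi> s = of_nat c0 * s + f 1 + g s"
    "\<And>\<sigma>. \<sigma>1 \<le> \<sigma> \<Longrightarrow> 1/2 + \<delta> \<le> real c0 * \<sigma> + Re (f 1) - K * 2 powr - \<sigma>"
proof -
  obtain \<sigma>0 where \<sigma>0: "\<sigma>0 \<ge> 0" "\<forall>s\<in>half_plane \<sigma>0. ds_converges f s"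
      "\<And>s. \<sigma>0 < Re s \<Longrightarrow> \<phi> s = of_nat c0 * s + ds_sum f s"
    using rep by auto
  define g where "g = (\<lambda>s. ds_sum f s - f 1)"
  obtain K \<sigma>2 where K: "\<sigma>0 < \<sigma>2" "\<And>\<sigma>. \<sigma>2 \<le> \<sigma> \<Longrightarrow> ds_rep \<sigma> (K * 2 powr - \<sigma>) g"
    using ds_rep_tail[OF \<sigma>0(2)] unfolding g_def by blast
  have \<phi>: "\<phi> s = of_nat c0 * s + f 1 + g s" if "\<sigma>2 \<le> Re s" for s
    using \<sigma>0(3)[of s] that K(1) by (simp add: g_def)
  have lim: "((\<lambda>\<sigma>. K * 2 powr - \<sigma>) \<longlongrightarrow> 0) at_top" by real_asymp
  have "\<exists>\<delta>>0. \<forall>\<^sub>F \<sigma> in at_top. 1/2 + \<delta> \<le> real c0 * \<sigma> + Re (f 1) - K * 2 powr - \<sigma>"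
  proof (cases "c0 = 0")
    case True
    define u where "u = Re (\<phi> 1) - 1/2"
    have u: "u > 0" using Re_symbol[of 1] by (simp add: u_def)
    have "Re (f 1) > 1/2"
    proof (rule ccontr)
      assume "\<not> 1/2 < Re (f 1)"
      have "\<forall>\<^sub>F \<sigma> in at_top. u \<le> K * \<sigma> * 2 powr - \<sigma>"
        using eventually_ge_at_top[of "max 1 \<sigma>2"]
      proof eventually_elim
        case (elim \<sigma>)
        have "Re (\<phi> (of_real \<sigma>)) - 1/2 \<le> norm (g (of_real \<sigma>))"
          using \<phi>[of "of_real \<sigma>"] True elim \<open>\<not> 1/2 < Re (f 1)\<close> complex_Re_le_cmod[of "g (of_real \<sigma>)"] by simp
        also have "\<dots> \<le> K * 2 powr - \<sigma>" using ds_rep_norm_le[OF K(2)] elim by simp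
        finally have le: "min (\<sigma> / 1) (1 / \<sigma>) * u \<le> K * 2 powr - \<sigma>"
          using harnack_symbol[of "of_real \<sigma>" 1] elim by (simp add: u_def)
        have "1 / \<sigma> \<le> 1" using elim by simp
        hence "1 / \<sigma> \<le> \<sigma> / 1" using elim by linarith
        hence "min (\<sigma> / 1) (1 / \<sigma>) = 1 / \<sigma>" by (rule min_absorb2)
        thus ?case using le elim by (simp only:) (simp add: field_simps)
      qed
      moreover have "((\<lambda>\<sigma>. K * \<sigma> * 2 powr - \<sigma>) \<longlongrightarrow> 0) at_top" by real_asymp
      ultimately have "u \<le> 0" by (intro tendsto_lowerbound) auto
      thus False using u by simp
    qed
    \<comment> \<open>Half of the gap above 1/2 becomes \<delta>; the other half absorbs K
      2^(-\<sigma>).\<close>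
    hence pos: "(Re (f 1) - 1/2) / 2 > 0" by simp
    from order_tendstoD(2)[OF lim this]
    have "\<forall>\<^sub>F \<sigma> in at_top. 1/2 + (Re (f 1) - 1/2) / 2 \<le> real c0 * \<sigma> + Re (f 1) - K * 2 powr - \<sigma>"
      by eventually_elim (use True in \<open>simp add: field_simps\<close>)
    thus ?thesis using pos by blast
  next
    case False
    \<comment> \<open>From \<sigma> \<ge> 5/2 - Re (f 1) and K 2^(-\<sigma>) < 1 the right side is
      at least 5/2 - 1 = 3/2.\<close>
    have "\<forall>\<^sub>F \<sigma> in at_top. 1/2 + 1 \<le> real c0 * \<sigma> + Re (f 1) - K * 2 powr - \<sigma>"
      using order_tendstoD(2)[OF lim zero_less_one] eventually_ge_at_top[of "5/2 - Re (f 1)"] eventually_ge_at_top[of 0]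
    proof eventually_elim
      case (elim \<sigma>)
      have "1 * \<sigma> \<le> real c0 * \<sigma>" using False elim by (intro mult_right_mono) auto
      thus ?case using elim by simp
    qed
    thus ?thesis by (intro exI[of _ 1]) simp
  qed
  then obtain \<delta> \<sigma>3 where \<delta>: "\<delta> > 0" "\<And>\<sigma>. \<sigma>3 \<le> \<sigma> \<Longrightarrow> 1/2 + \<delta> \<le> real c0 * \<sigma> + Re (f 1) - K * 2 powr - \<sigma>"
    unfolding eventually_at_top_linorder by blast
  show ?thesis
    by (rule that[of "max 1 (max \<sigma>2 \<sigma>3)" \<delta> K g]) (use \<delta> K \<phi> in auto)
qed

text \<open>For Re s \<ge> \<sigma>1 the expansion gives the bound \<delta> at every height. A point
  further left is compared with the point of the line Re w = \<sigma>1 at the same height; the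
  Harnack factor is at least min(1, \<tau>/\<sigma>1), so the bound is uniform in Im s.\<close>

lemma symbol_away_from_boundary:
  assumes \<tau>: "0 < \<tau>"
  shows "\<exists>\<epsilon>>0. \<forall>s. \<tau> < Re s \<longrightarrow> 1/2 + \<epsilon> \<le> Re (\<phi> s)"
proof -
  obtain g K \<sigma>1 \<delta> where *: "0 < \<sigma>1" "0 < \<delta>"
    "\<And>\<sigma>. \<sigma>1 \<le> \<sigma> \<Longrightarrow> ds_rep \<sigma> (K * 2 powr - \<sigma>) g"
    "\<And>s. \<sigma>1 \<le> Re s \<Longrightarrow> \<phi> s = of_nat c0 * s + f 1 + g s"
    "\<And>\<sigma>. \<sigma>1 \<le> \<sigma> \<Longrightarrow> 1/2 + \<delta> \<le> real c0 * \<sigma> + Re (f 1) - K * 2 powr - \<sigma>"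
    by (rule symbol_expansion) blast
  have far: "\<delta> \<le> Re (\<phi> s) - 1/2" if "\<sigma>1 \<le> Re s" for s
  proof -
    have "norm (g s) \<le> K * 2 powr - Re s" using ds_rep_norm_le[OF *(3)[OF that], of s] by simp
    hence "- (K * 2 powr - Re s) \<le> Re (g s)" using abs_Re_le_cmod[of "g s"] by linarith
    thus ?thesis using *(4,5)[OF that] by simp
  qed
  define \<epsilon> where "\<epsilon> = min 1 (\<tau> / \<sigma>1) * \<delta>"
  have "\<epsilon> \<le> Re (\<phi> s) - 1/2" if s: "\<tau> < Re s" for s
  proof (cases "\<sigma>1 \<le> Re s")
    case True
    have "\<epsilon> \<le> 1 * \<delta>" unfolding \<epsilon>_def using * by (intro mult_right_mono) auto
    thus ?thesis using far[OF True] by simp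
  next
    case False
    define w where "w = Complex \<sigma>1 (Im s)"
    have "min 1 (\<tau> / \<sigma>1) \<le> min (Re s / Re w) (Re w / Re s)"
    proof -
      have "\<tau> / \<sigma>1 \<le> Re s / Re w" using s *(1) by (simp add: w_def divide_right_mono)
      moreover have "1 \<le> Re w / Re s" using False s \<tau> by (simp add: w_def)
      ultimately show ?thesis
        using min.cobounded1[of 1 "\<tau> / \<sigma>1"] min.cobounded2[of 1 "\<tau> / \<sigma>1"] by (intro min.boundedI) linarith+
    qed
    hence "\<epsilon> \<le> min (Re s / Re w) (Re w / Re s) * (Re (\<phi> w) - 1/2)"
      unfolding \<epsilon>_def using far[of w] * \<tau> s by (intro mult_mono) (auto simp: w_def)
    also have "\<dots> \<le> Re (\<phi> s) - 1/2"
      by (rule harnack_symbol) (use s \<tau> * in \<open>auto simp: w_def\<close>)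
    finally show ?thesis .
  qed
  moreover have "\<epsilon> > 0" using * \<tau> by (simp add: \<epsilon>_def)
  ultimately show ?thesis by (intro exI[of _ \<epsilon>]) (auto simp: algebra_simps)
qed

text \<open>The exponent demanded by \<open>ds_rep_compose\<close> is the lower bound for Re \<phi>
  in the last clause of \<open>symbol_expansion\<close>. It exceeds 1/2, exactly where series in
  \<open>H_plus\<close> converge absolutely.\<close>

lemma composition_dirichlet_series:
  assumes a: "a \<in> H_plus"
  obtains b c where "0 < c" "summable (\<lambda>n. norm (b (Suc n)) * real (Suc n) powr - c)"
    "\<And>s. c \<le> Re s \<Longrightarrow> ds_term b s sums ds_sum a (\<phi> s)"
proof -
  obtain g K c \<delta> where *: "0 < c" "0 < \<delta>"
    "\<And>\<sigma>. c \<le> \<sigma> \<Longrightarrow> ds_rep \<sigma> (K * 2 powr - \<sigma>) g"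
    "\<And>s. c \<le> Re s \<Longrightarrow> \<phi> s = of_nat c0 * s + f 1 + g s"
    "\<And>\<sigma>. c \<le> \<sigma> \<Longrightarrow> 1/2 + \<delta> \<le> real c0 * \<sigma> + Re (f 1) - K * 2 powr - \<sigma>"
    by (rule symbol_expansion) blast
  have "summable (\<lambda>n. norm (a (Suc n)) * real (Suc n) powr - (real c0 * c + Re (f 1) - K * 2 powr - c))"
    using *(2) *(5)[of c] by (intro H_plus_abs_summable[OF a]) simp
  then obtain N' where "ds_rep c N' (\<lambda>s. ds_sum a (of_nat c0 * s + f 1 + g s))"
    using ds_rep_compose[OF *(3)[OF order_refl]] by blast
  hence "ds_rep c N' (\<lambda>s. ds_sum a (\<phi> s))" by (rule ds_rep_cong) (simp add: *(4))
  then obtain b where "summable (\<lambda>n. norm (b (Suc n)) * real (Suc n) powr - c)"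
    "\<And>s. c \<le> Re s \<Longrightarrow> ds_term b s sums ds_sum a (\<phi> s)"
    by (rule ds_rep_imp_sums) blast
  with *(1) show ?thesis by (rule that)
qed

lemma H_plus_converges_symbol: "a \<in> H_plus \<Longrightarrow> 0 < Re s \<Longrightarrow> ds_converges a (\<phi> s)"
  using abs_summable_ds(1)[OF H_plus_abs_summable[of a "Re (\<phi> s)"], of "\<phi> s"] Re_symbol[of s]
  by (auto simp: ds_converges_def sums_iff)

lemma holomorphic_composition:
  assumes "a \<in> H_plus"
  shows "(\<lambda>s. ds_sum a (\<phi> s)) holomorphic_on half_plane 0"
  using holomorphic_on_compose_gen[OF hol H_plus_holomorphic[OF assms] into] by (simp add: o_def)

lemma represents_compI:
  assumes "a \<in> H_plus" "0 < c" "\<And>s. c \<le> Re s \<Longrightarrow> ds_term b s sums ds_sum a (\<phi> s)"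
  shows "represents_comp \<phi> a b"
  unfolding represents_comp_def
proof (intro exI[of _ c] conjI ballI)
  fix s assume "s \<in> half_plane c"
  hence s: "c \<le> Re s" by simp
  show "ds_converges a (\<phi> s)" by (rule H_plus_converges_symbol) (use assms s in auto)
  show "ds_converges b s" "ds_sum b s = ds_sum a (\<phi> s)"
    using assms(3)[OF s] by (auto simp: ds_converges_def ds_sum_def sums_iff)
qed (use assms in simp)

lemma H_plus_bounded_composition:
  assumes a: "a \<in> H_plus" and \<epsilon>: "0 < \<epsilon>"
  obtains M where "\<And>s. 1/2 + \<epsilon> \<le> Re (\<phi> s) \<Longrightarrow> norm (ds_sum a (\<phi> s)) \<le> M"
proof (rule that)
  have "1/2 < 1/2 + \<epsilon>" using \<epsilon> by simp
  from abs_summable_ds(2)[OF H_plus_abs_summable[OF a this]]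
  show "norm (ds_sum a (\<phi> s)) \<le> (\<Sum>n. norm (a (Suc n)) * real (Suc n) powr - (1/2 + \<epsilon>))"
    if "1/2 + \<epsilon> \<le> Re (\<phi> s)" for s using that .
qed

section \<open>The inclusions into \<open>H_inf\<close> and \<open>H_inf_plus\<close>\<close>

lemma comp_into_H_inf:
  assumes \<epsilon>: "0 < \<epsilon>" and sub: "\<phi> ` half_plane 0 \<subseteq> half_plane (1/2 + \<epsilon>)"
  shows "comp_maps_into \<phi> H_plus H_inf"
  unfolding comp_maps_into_def
proof
  fix a assume a: "a \<in> H_plus"
  obtain b c where b: "0 < c" "summable (\<lambda>n. norm (b (Suc n)) * real (Suc n) powr - c)"
    "\<And>s. c \<le> Re s \<Longrightarrow> ds_term b s sums ds_sum a (\<phi> s)"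
    by (rule composition_dirichlet_series[OF a]) blast
  obtain M where M: "\<And>s. 1/2 + \<epsilon> \<le> Re (\<phi> s) \<Longrightarrow> norm (ds_sum a (\<phi> s)) \<le> M"
    using H_plus_bounded_composition[OF a \<epsilon>] by blast
  have "b \<in> H_inf"
  proof (rule bohr_H_inf[OF holomorphic_composition[OF a] _ b(2,3)])
    show "norm (ds_sum a (\<phi> w)) \<le> M" if "0 < Re w" for w
      using sub that by (intro M) (auto simp: image_subset_iff intro: less_imp_le)
  qed
  thus "\<exists>b\<in>H_inf. represents_comp \<phi> a b" using represents_compI[OF a b(1,3)] by blast
qed

text \<open>Dividing the coefficients by n^\<tau> translates the sum by \<tau>, and \<phi>(s +
  \<tau>) keeps a positive distance from the line Re = 1/2. One series b serves all \<tau>; only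
  \<epsilon> and M depend on it.\<close>

lemma comp_into_H_inf_plus: "comp_maps_into \<phi> H_plus H_inf_plus"
  unfolding comp_maps_into_def
proof
  fix a assume a: "a \<in> H_plus"
  obtain b c where b: "0 < c" "summable (\<lambda>n. norm (b (Suc n)) * real (Suc n) powr - c)"
    "\<And>s. c \<le> Re s \<Longrightarrow> ds_term b s sums ds_sum a (\<phi> s)"
    by (rule composition_dirichlet_series[OF a]) blast
  have "b \<in> H_inf_plus" unfolding H_inf_plus_def
  proof (intro CollectI allI impI)
    fix \<tau> :: real assume \<tau>: "0 < \<tau>"
    obtain \<epsilon> where \<epsilon>: "0 < \<epsilon>" "\<And>s. \<tau> < Re s \<Longrightarrow> 1/2 + \<epsilon> \<le> Re (\<phi> s)"
      using symbol_away_from_boundary[OF \<tau>] by blast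
    obtain M where M: "\<And>s. 1/2 + \<epsilon> \<le> Re (\<phi> s) \<Longrightarrow> norm (ds_sum a (\<phi> s)) \<le> M"
      using H_plus_bounded_composition[OF a \<epsilon>(1)] by blast
    define b' where "b' = (\<lambda>n. b n / of_real (real n powr \<tau>))"
    define F where "F = (\<lambda>s. ds_sum a (\<phi> (s + of_real \<tau>)))"
    have shift: "ds_term b' s = ds_term b (s + of_real \<tau>)" for s
    proof
      fix n
      have "(of_real (real (Suc n) powr \<tau>) :: complex) = of_nat (Suc n) powr of_real \<tau>"
        using powr_of_real[of "real (Suc n)" \<tau>] by simp
      thus "ds_term b' s n = ds_term b (s + of_real \<tau>) n"
        by (simp add: ds_term_def b'_def powr_add powr_minus powr_diff field_simps del: of_nat_Suc)
    qed
    have "b' \<in> H_inf"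
    proof (rule bohr_H_inf)
      have "(\<lambda>s. s + of_real \<tau>) ` half_plane 0 \<subseteq> half_plane 0" using \<tau> by auto
      from holomorphic_on_compose_gen[OF _ holomorphic_composition[OF a] this]
      show "F holomorphic_on half_plane 0" by (simp add: F_def[abs_def] o_def holomorphic_intros)
      show "norm (F w) \<le> M" if "0 < Re w" for w
        unfolding F_def using that by (intro M \<epsilon>(2)) simp
      show "summable (\<lambda>n. norm (b' (Suc n)) * real (Suc n) powr - c)"
      proof (rule summable_comparison_test'[OF b(2), where N = 0])
        fix n
        have "1 \<le> real (Suc n) powr \<tau>" using \<tau> by (intro ge_one_powr_ge_zero) auto
        hence "norm (b' (Suc n)) \<le> norm (b (Suc n))"
          by (simp add: b'_def norm_divide divide_le_eq mult_left_le del: of_nat_Suc)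
             (metis mult.right_neutral mult_left_mono norm_ge_zero)
        thus "norm (norm (b' (Suc n)) * real (Suc n) powr - c) \<le> norm (b (Suc n)) * real (Suc n) powr - c"
          by (simp add: mult_right_mono)
      qed
      show "ds_term b' w sums F w" if "c \<le> Re w" for w
        unfolding shift F_def using that \<tau> by (intro b(3)) simp
    qed
    thus "(\<lambda>n. b n / of_real (real n powr \<tau>)) \<in> H_inf" by (simp add: b'_def)
  qed
  thus "\<exists>b\<in>H_inf_plus. represents_comp \<phi> a b" using represents_compI[OF a b(1,3)] by blast
qed

text \<open>If the range approaches the line, the hump series a is unbounded on it. The representing
  b in \<open>H_inf\<close> agrees with the composition far to the right, hence on all of Re s > 0
  by the identity theorem, contradicting its boundedness.\<close>

lemma comp_into_H_infD:
  assumes "comp_maps_into \<phi> H_plus H_inf"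
  shows "\<exists>\<epsilon>>0. \<phi> ` half_plane 0 \<subseteq> half_plane (1/2 + \<epsilon>)"
proof (rule ccontr)
  assume contra: "\<not> ?thesis"
  have near: "\<exists>w\<in>\<phi> ` half_plane 0. Re w \<le> 1/2 + \<epsilon>" if "0 < \<epsilon>" for \<epsilon>
  proof (rule ccontr)
    assume "\<not> ?thesis"
    hence "\<phi> ` half_plane 0 \<subseteq> half_plane (1/2 + \<epsilon>)" by (auto simp: not_le)
    thus False using contra that by blast
  qed
  obtain a where a: "a \<in> H_plus" "\<not> bounded (ds_sum a ` \<phi> ` half_plane 0)"
    by (rule H_plus_unbounded_near_boundary[OF _ near]) (use Re_symbol in auto)
  obtain b where b: "b \<in> H_inf" "represents_comp \<phi> a b"
    using assms a(1) unfolding comp_maps_into_def by blast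
  obtain \<sigma> where \<sigma>: "\<And>s. \<sigma> < Re s \<Longrightarrow> ds_sum b s = ds_sum a (\<phi> s)"
  proof -
    obtain \<sigma> where "\<forall>s\<in>half_plane \<sigma>. ds_sum b s = ds_sum a (\<phi> s)"
      using b(2) unfolding represents_comp_def by blast
    thus ?thesis by (intro that[of \<sigma>]) simp
  qed
  have "ds_sum b s = ds_sum a (\<phi> s)" if "s \<in> half_plane 0" for s
    by (rule half_plane_identity[where f = "ds_sum b" and g = "\<lambda>s. ds_sum a (\<phi> s)" and c = \<sigma>])
       (use b(1) holomorphic_composition[OF a(1)] \<sigma> that in \<open>auto simp: H_inf_def\<close>)
  hence "ds_sum a ` \<phi> ` half_plane 0 = ds_sum b ` half_plane 0"
    unfolding image_image by (intro image_cong) auto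
  thus False using a(2) b(1) by (simp add: H_inf_def)
qed

end

theorem theorem4p6:
  fixes \<phi> :: "complex \<Rightarrow> complex" and c0 :: nat and f :: dirichlet_series
  assumes "\<phi> holomorphic_on half_plane 0"
    and "\<phi> ` half_plane 0 \<subseteq> half_plane (1/2)"
    and "f \<in> D_space"
    and "\<exists>\<sigma>\<ge>0. \<forall>s\<in>half_plane \<sigma>. ds_converges f s \<and> \<phi> s = of_nat c0 * s + ds_sum f s"
  shows "(comp_maps_into \<phi> H_plus H_inf \<longleftrightarrow>
            (\<exists>\<epsilon>>0. \<phi> ` half_plane 0 \<subseteq> half_plane (1/2 + \<epsilon>))) \<and>
         (comp_maps_into \<phi> H_plus H_inf_plus \<longleftrightarrow>
            \<phi> ` half_plane 0 \<subseteq> half_plane (1/2))"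
  using comp_into_H_inf[OF assms(1,2,4)] comp_into_H_infD[OF assms(1,2,4)]
    comp_into_H_inf_plus[OF assms(1,2,4)] assms(2) by blast

end
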